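(* Let $n,m\ge 1$ be integers and let $a,b$ be two positive real numbers such that $a/b\in\mathbb{Q}$. Suppose that the Fubini-Study spaces $\mathbf{F}(n,b)$ and $\mathbf{F}(m,a)$ are relatives. Moreover, assume $sa=rb$ for positive integers $s,r$ with $\gcd(s,r)=1$. Then $$r+1\le\binom{s+m}{s}\quad\text{and}\quad s+1\le\binom{r+n}{r}.$$
   Context: For $b>0$, the Fubini-Study space $\mathbf{F}(n,b)$ is the complex projective space $\mathbb{CP}^n$ with the Kähler metric whose Kähler potential is locally (in suitable affine coordinates $Z=(z_1,\dots,z_n)$) given by $\frac1b\log(1+b|Z|^2)$, where $|Z|^2=\sum_{i=1}^n|z_i|^2$; i.e. the Kähler form is $\sqrt{-1}\,\partial\bar\partial$ of this function. Two Kähler manifolds are called relatives when they share a common positive-dimensional Kähler submanifold, i.e. a positive-dimensional complex submanifold of one of them endowed with the induced metric is biholomorphically isometric to a complex submanifold of the other endowed with the induced metric. *)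

theory Defs
  imports "HOL-Analysis.Analysis" "HOL-Combinatorics.Transposition"
begin

section \<open>Holomorphic maps of several variables\<close>

definition holomorphic_map :: "(complex^'n \<Rightarrow> complex^'m) \<Rightarrow> (complex^'n) set \<Rightarrow> bool" where
  "holomorphic_map f V \<longleftrightarrow> open V \<and>
     (\<forall>z\<in>V. \<exists>f'. (f has_derivative f') (at z) \<and> (\<forall>c v. f' (c *s v) = c *s f' v))"

definition biholomorphic_map ::
  "(complex^'n \<Rightarrow> complex^'m) \<Rightarrow> (complex^'n) set \<Rightarrow> (complex^'m) set \<Rightarrow> bool" where
  "biholomorphic_map f V W \<longleftrightarrow>
     bij_betw f V W \<and> holomorphic_map f V \<and> holomorphic_map (inv_into V f) W"


section \<open>The metric defined by a Kaehler potential\<close>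

definition wirtinger :: "'n \<Rightarrow> (complex^'n \<Rightarrow> complex) \<Rightarrow> complex^'n \<Rightarrow> complex" where
  "wirtinger i f z =
     (frechet_derivative f (at z) (axis i 1) - \<i> * frechet_derivative f (at z) (axis i \<i>)) / 2"

definition wirtinger_bar :: "'n \<Rightarrow> (complex^'n \<Rightarrow> complex) \<Rightarrow> complex^'n \<Rightarrow> complex" where
  "wirtinger_bar i f z =
     (frechet_derivative f (at z) (axis i 1) + \<i> * frechet_derivative f (at z) (axis i \<i>)) / 2"

definition levi_matrix :: "(complex^'n \<Rightarrow> real) \<Rightarrow> complex^'n \<Rightarrow> 'n \<Rightarrow> 'n \<Rightarrow> complex" where
  "levi_matrix \<Phi> z i j = wirtinger i (wirtinger_bar j (\<lambda>w. complex_of_real (\<Phi> w))) z"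

text \<open>
  The real 2-form \<open>\<i> \<partial>\<partial>\<^sup>-\<Phi> = \<i> \<Sum> g\<^sub>i\<^sub>j dz\<^sub>i \<and> dz\<^sup>-\<^sub>j\<close>, evaluated on two tangent vectors.
  The matrix \<open>g\<close> is Hermitian for a \<open>C\<^sup>2\<close> potential, so the sum is real and \<open>Re\<close> is only a
  change of type.  The metric is recovered from the form by \<open>g(u, v) = \<omega>(u, J v)\<close>.
\<close>

definition kahler_form ::
  "(complex^'n \<Rightarrow> real) \<Rightarrow> complex^'n \<Rightarrow> complex^'n \<Rightarrow> complex^'n \<Rightarrow> real" where
  "kahler_form \<Phi> z u v =
     Re (\<i> * (\<Sum>i\<in>UNIV. \<Sum>j\<in>UNIV.
       levi_matrix \<Phi> z i j * (u $ i * cnj (v $ j) - v $ i * cnj (u $ j))))"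

definition kahler_metric ::
  "(complex^'n \<Rightarrow> real) \<Rightarrow> complex^'n \<Rightarrow> complex^'n \<Rightarrow> complex^'n \<Rightarrow> real" where
  "kahler_metric \<Phi> z u v = kahler_form \<Phi> z u (\<i> *s v)"


section \<open>Kaehler manifolds, submanifolds and relatives\<close>

text \<open>
  A Kaehler manifold is given by an atlas of local parametrisations, each carrying a Kaehler
  potential for the metric in its coordinates.  The notions below are meant for atlases whose
  parametrisations are injective on open domains, with holomorphic isometric transition maps,
  so that nothing depends on the charts chosen.
\<close>

record ('a, 'n::finite) kahler_chart =
  chart_dom :: "(complex^'n) set"
  param :: "complex^'n \<Rightarrow> 'a"
  potential :: "complex^'n \<Rightarrow> real"

type_synonym ('a, 'n) kahler_atlas = "('a, 'n) kahler_chart set"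

definition points :: "('a, 'n::finite) kahler_atlas \<Rightarrow> 'a set" where
  "points M = (\<Union>c\<in>M. param c ` chart_dom c)"

definition in_chart :: "('a, 'n::finite) kahler_chart \<Rightarrow> 'a set \<Rightarrow> (complex^'n) set" where
  "in_chart c S = {z \<in> chart_dom c. param c z \<in> S}"

text \<open>
  Embedded complex submanifolds of dimension \<open>k\<close>: near each point, suitable holomorphic
  coordinates \<open>F\<close> turn the set into a \<open>k\<close>-dimensional coordinate plane.
\<close>

definition complex_submanifold :: "('a, 'n::finite) kahler_atlas \<Rightarrow> nat \<Rightarrow> 'a set \<Rightarrow> bool" where
  "complex_submanifold M k S \<longleftrightarrow> S \<noteq> {} \<and> S \<subseteq> points M \<and>
     (\<forall>p\<in>S. \<exists>c\<in>M. \<exists>V W (F :: complex^'n \<Rightarrow> complex^'n) I.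
        V \<subseteq> chart_dom c \<and> p \<in> param c ` V \<and> biholomorphic_map F V W \<and> card I = k \<and>
        F ` (V \<inter> in_chart c S) = {w \<in> W. \<forall>i. i \<notin> I \<longrightarrow> w $ i = 0})"

definition tangent_space :: "(complex^'n) set \<Rightarrow> complex^'n \<Rightarrow> (complex^'n) set" where
  "tangent_space X z = {u. \<exists>\<gamma> :: real \<Rightarrow> complex^'n.
     \<gamma> 0 = z \<and> (\<gamma> has_vector_derivative u) (at 0) \<and> (\<forall>\<^sub>F t in at 0. \<gamma> t \<in> X)}"

text \<open>
  \<open>h\<close> is a holomorphic map between coordinate domains which represents \<open>\<phi>\<close> on \<open>S\<close> near the point
  with coordinates \<open>z\<close>.  Away from \<open>S\<close> it is an arbitrary extension; only its derivative along
  \<open>S\<close> is determined by \<open>\<phi>\<close>.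
\<close>

definition local_rep ::
  "('a, 'n::finite) kahler_chart \<Rightarrow> ('b, 'm::finite) kahler_chart \<Rightarrow> 'a set \<Rightarrow> ('a \<Rightarrow> 'b) \<Rightarrow>
   complex^'n \<Rightarrow> (complex^'n) set \<Rightarrow> (complex^'n \<Rightarrow> complex^'m) \<Rightarrow> bool" where
  "local_rep c d S \<phi> z V h \<longleftrightarrow>
     z \<in> V \<and> V \<subseteq> chart_dom c \<and> holomorphic_map h V \<and> h ` V \<subseteq> chart_dom d \<and>
     (\<forall>w \<in> V \<inter> in_chart c S. \<phi> (param c w) = param d (h w))"

definition holomorphic_between ::
  "('a, 'n::finite) kahler_atlas \<Rightarrow> 'a set \<Rightarrow> ('b, 'm::finite) kahler_atlas \<Rightarrow> ('a \<Rightarrow> 'b) \<Rightarrow> bool"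
where
  "holomorphic_between M S N \<phi> \<longleftrightarrow>
     (\<forall>c\<in>M. \<forall>d\<in>N. \<forall>z \<in> in_chart c S. \<phi> (param c z) \<in> param d ` chart_dom d \<longrightarrow>
        (\<exists>V h. local_rep c d S \<phi> z V h))"

text \<open>
  \<open>\<phi>\<close> preserves the induced metrics, that is, the restrictions of the ambient metrics to the
  tangent spaces of the submanifolds.
\<close>

definition isometric_on ::
  "('a, 'n::finite) kahler_atlas \<Rightarrow> 'a set \<Rightarrow> ('b, 'm::finite) kahler_atlas \<Rightarrow> ('a \<Rightarrow> 'b) \<Rightarrow> bool"
where
  "isometric_on M S N \<phi> \<longleftrightarrow>
     (\<forall>c\<in>M. \<forall>d\<in>N. \<forall>z \<in> in_chart c S. \<forall>V h. local_rep c d S \<phi> z V h \<longrightarrow>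
        (\<forall>u \<in> tangent_space (in_chart c S) z. \<forall>v \<in> tangent_space (in_chart c S) z.
           kahler_metric (potential d) (h z)
             (frechet_derivative h (at z) u) (frechet_derivative h (at z) v) =
           kahler_metric (potential c) z u v))"

definition biholomorphic_isometry ::
  "('a, 'n::finite) kahler_atlas \<Rightarrow> 'a set \<Rightarrow> ('b, 'm::finite) kahler_atlas \<Rightarrow> 'b set \<Rightarrow>
   ('a \<Rightarrow> 'b) \<Rightarrow> bool" where
  "biholomorphic_isometry M S N T \<phi> \<longleftrightarrow>
     bij_betw \<phi> S T \<and> holomorphic_between M S N \<phi> \<and> holomorphic_between N T M (inv_into S \<phi>) \<and>
     isometric_on M S N \<phi>"

definition relatives ::
  "('a, 'n::finite) kahler_atlas \<Rightarrow> ('b, 'm::finite) kahler_atlas \<Rightarrow> bool" where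
  "relatives M N \<longleftrightarrow>
     (\<exists>k l S T \<phi>. k \<ge> 1 \<and> complex_submanifold M k S \<and> complex_submanifold N l T \<and>
        biholomorphic_isometry M S N T \<phi>)"


section \<open>Fubini-Study spaces\<close>

text \<open>
  \<open>CP\<^sup>n\<close> with \<open>n = CARD('n)\<close>, as the set of complex lines through the origin of \<open>C\<^sup>n\<^sup>+\<^sup>1\<close>; the
  homogeneous coordinates are indexed by \<open>'n option\<close>.
\<close>

definition complex_line :: "complex^'k \<Rightarrow> (complex^'k) set" where
  "complex_line v = range (\<lambda>c. c *s v)"

definition complex_projective_space :: "'n::finite itself \<Rightarrow> (complex^('n option)) set set" where
  "complex_projective_space _ = {complex_line v | v. v \<noteq> 0}"

definition fs_potential :: "real \<Rightarrow> complex^'n \<Rightarrow> real" where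
  "fs_potential b Z = 1 / b * ln (1 + b * (\<Sum>i\<in>UNIV. (cmod (Z $ i))\<^sup>2))"

text \<open>
  The affine chart on which the homogeneous coordinate \<open>j\<close> is nonzero.  The transposition
  swaps \<open>j\<close> with the homogeneous coordinate \<open>None\<close>.  In the usual affine coordinates the potential
  is \<open>1/b log (1 + \<bar>w\<bar>\<^sup>2)\<close>; the factor \<open>sqrt b\<close> is the rescaling \<open>w = sqrt b Z\<close> which brings it
  to the form \<open>1/b log (1 + b \<bar>Z\<bar>\<^sup>2)\<close> and with which the potentials of the different charts define
  one and the same form on overlaps.
\<close>

definition affine_lift :: "real \<Rightarrow> 'n::finite option \<Rightarrow> complex^'n \<Rightarrow> complex^('n option)" where
  "affine_lift b j Z =
     (\<chi> l. case Transposition.transpose None j l of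
             None \<Rightarrow> 1 | Some i \<Rightarrow> complex_of_real (sqrt b) * Z $ i)"

definition fs_chart ::
  "real \<Rightarrow> 'n::finite option \<Rightarrow> ((complex^('n option)) set, 'n) kahler_chart" where
  "fs_chart b j =
     \<lparr>chart_dom = UNIV, param = (\<lambda>Z. complex_line (affine_lift b j Z)), potential = fs_potential b\<rparr>"

definition fubini_study ::
  "'n::finite itself \<Rightarrow> real \<Rightarrow> ((complex^('n option)) set, 'n) kahler_atlas" where
  "fubini_study _ b = range (fs_chart b)"

lemma affine_lift_base: "affine_lift b j Z $ j = 1"
  by (simp add: affine_lift_def)

lemma inj_param_fs_chart:
  assumes "b > 0"
  shows "inj (param (fs_chart b (j :: 'n::finite option)))"
proof (rule injI)
  fix Y Z :: "complex^'n"
  assume "param (fs_chart b j) Y = param (fs_chart b j) Z"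
  then have eq: "complex_line (affine_lift b j Y) = complex_line (affine_lift b j Z)"
    by (simp add: fs_chart_def)
  have "1 *s affine_lift b j Y \<in> complex_line (affine_lift b j Y)"
    unfolding complex_line_def by (rule rangeI)
  then obtain c where c: "affine_lift b j Y = c *s affine_lift b j Z"
    unfolding eq by (auto simp: complex_line_def)
  then have "c = 1"
    using affine_lift_base[of b j Y] affine_lift_base[of b j Z] by simp
  with c have lift: "affine_lift b j Y = affine_lift b j Z" by simp
  show "Y = Z"
  proof (rule vec_eq_iff[THEN iffD2], rule allI)
    fix i
    have "affine_lift b j Y $ Transposition.transpose None j (Some i) =
          affine_lift b j Z $ Transposition.transpose None j (Some i)"
      using lift by simp
    then show "Y $ i = Z $ i"
      using assms by (simp add: affine_lift_def)
  qed
qed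

lemma points_fubini_study:
  assumes "b > 0"
  shows "points (fubini_study TYPE('n::finite) b) = complex_projective_space TYPE('n)"
proof (intro equalityI subsetI)
  fix L :: "(complex^('n option)) set"
  assume "L \<in> points (fubini_study TYPE('n) b)"
  then obtain j Z where L: "L = complex_line (affine_lift b (j :: 'n option) Z)"
    by (auto simp: points_def fubini_study_def fs_chart_def)
  have "affine_lift b j Z \<noteq> 0"
    using affine_lift_base[of b j Z] by auto
  with L show "L \<in> complex_projective_space TYPE('n)"
    by (auto simp: complex_projective_space_def)
next
  fix L :: "(complex^('n option)) set"
  assume "L \<in> complex_projective_space TYPE('n)"
  then obtain v :: "complex^('n option)" where v: "v \<noteq> 0" "L = complex_line v"
    by (auto simp: complex_projective_space_def)
  then obtain j where j: "v $ j \<noteq> 0" by (auto simp: vec_eq_iff)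
  define Z :: "complex^'n" where
    "Z = (\<chi> i. v $ Transposition.transpose None j (Some i) / (v $ j * complex_of_real (sqrt b)))"
  have vZ: "v = v $ j *s affine_lift b j Z"
  proof (rule vec_eq_iff[THEN iffD2], rule allI)
    fix l
    show "v $ l = (v $ j *s affine_lift b j Z) $ l"
    proof (cases "Transposition.transpose None j l")
      case None
      then have "l = j" by (metis transpose_apply_first transpose_involutory)
      then show ?thesis by (simp add: affine_lift_base)
    next
      case (Some i)
      then have "Transposition.transpose None j (Some i) = l"
        by (metis transpose_involutory)
      with Some j assms show ?thesis by (simp add: affine_lift_def Z_def)
    qed
  qed
  have "complex_line v = complex_line (affine_lift b j Z)"
  proof (intro equalityI subsetI)
    fix x assume "x \<in> complex_line v"
    then obtain c where "x = c *s v" by (auto simp: complex_line_def)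
    then have "x = (c * v $ j) *s affine_lift b j Z"
      using vZ by (metis vector_smult_assoc)
    then show "x \<in> complex_line (affine_lift b j Z)" by (auto simp: complex_line_def)
  next
    fix x assume "x \<in> complex_line (affine_lift b j Z)"
    then obtain c where x: "x = c *s affine_lift b j Z" by (auto simp: complex_line_def)
    have "(c / v $ j) *s v = (c / v $ j) *s (v $ j *s affine_lift b j Z)"
      using vZ by simp
    also have "\<dots> = x" using x j by (simp add: vector_smult_assoc)
    finally show "x \<in> complex_line v" by (auto simp: complex_line_def)
  qed
  then have "L = param (fs_chart b j) Z" using v by (simp add: fs_chart_def)
  then show "L \<in> points (fubini_study TYPE('n) b)"
    by (auto simp: points_def fubini_study_def fs_chart_def)
qed

end

theory Submission
  imports Defs "HOL-Complex_Analysis.Complex_Analysis"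
begin

text \<open>
  A complex curve inside the common submanifold gives holomorphic curves \<open>f\<close> and \<open>g\<close> in affine charts
  of the two spaces on which the metrics agree, so \<open>r log (1 + b |f|\<^sup>2) - s log (1 + a |g|\<^sup>2)\<close> is
  annihilated by \<open>\<partial>\<partial>\<^sup>-\<close>.  Polarising this identity and integrating it once in each variable gives
  \<open>(1 + b f(z) f(w)\<^sup>*)\<^sup>r = \<phi>(z) \<psi>(w) (1 + a g(z) g(w)\<^sup>*)\<^sup>s\<close>.  The kernel on the right is a sum of at most
  \<open>(s + m) choose s\<close> products, one for each monomial of degree at most \<open>s\<close> in \<open>g\<close>.  The kernel on the left
  is positive with feature functions \<open>f\<^sup>\<alpha>\<close>, \<open>|\<alpha>| \<le> r\<close>, among which are the \<open>r + 1\<close> independent powers of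
  a nonconstant component of \<open>f\<close>.  Comparing ranks gives one inequality, exchanging the roles of \<open>f\<close> and
  \<open>g\<close> the other.
\<close>

section \<open>Ranks of powers of Hermitian kernels\<close>

text \<open>Gaussian elimination. The equations form a set, so coinciding equations count once; this
  lets the rank count below run over distinct monomials.\<close>

lemma homogeneous_system_nontrivial:
  fixes E :: "(nat \<Rightarrow> 'a::field) set"
  assumes "finite E" "card E < n"
  shows "\<exists>c. (\<exists>i<n. c i \<noteq> 0) \<and> (\<forall>e\<in>E. (\<Sum>i<n. c i * e i) = 0)"
  using assms
proof (induction n arbitrary: E)
  case 0
  then show ?case by simp
next
  case (Suc n)
  show ?case
  proof (cases "\<forall>e\<in>E. e n = 0")
    case True
    then show ?thesis
      by (intro exI[of _ "\<lambda>i. if i = n then 1 else 0"]) auto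
  next
    case False
    then obtain e0 where e0: "e0 \<in> E" "e0 n \<noteq> 0" by blast
    \<comment> \<open>The pivot \<open>e0\<close> eliminates the unknown with index
      \<open>n\<close>; rows that become equal merge, which only lowers the cardinality.\<close>
    define E' where "E' = (\<lambda>e i. e i - e n / e0 n * e0 i) ` (E - {e0})"
    have "card E' \<le> card (E - {e0})"
      unfolding E'_def using Suc.prems by (intro card_image_le) simp
    also have "\<dots> < n"
      using Suc.prems e0 card_gt_0_iff[of E] by auto
    finally have "card E' < n" .
    moreover have "finite E'" unfolding E'_def using Suc.prems by simp
    ultimately obtain c where c: "\<exists>i<n. c i \<noteq> 0"
      and zero: "\<And>e. e \<in> E' \<Longrightarrow> (\<Sum>i<n. c i * e i) = 0"
      using Suc.IH[of E'] by blast
    define d where "d = (\<lambda>i. if i = n then - (\<Sum>i<n. c i * e0 i) / e0 n else c i)"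
    have split: "(\<Sum>i<Suc n. d i * e i) =
        (\<Sum>i<n. c i * e i) - (\<Sum>i<n. c i * e0 i) / e0 n * e n" for e
      by (simp add: d_def)
    have "(\<Sum>i<Suc n. d i * e i) = 0" if "e \<in> E" for e
    proof (cases "e = e0")
      case True
      then show ?thesis unfolding split using e0 by simp
    next
      case False
      with that have "(\<Sum>i<n. c i * (e i - e n / e0 n * e0 i)) = 0"
        by (intro zero) (auto simp: E'_def)
      moreover have "(\<Sum>i<n. c i * (e i - e n / e0 n * e0 i)) =
          (\<Sum>i<n. c i * e i) - (\<Sum>i<n. c i * e0 i) / e0 n * e n"
        by (simp add: algebra_simps sum_subtractf sum_distrib_left sum_divide_distrib)
      ultimately show ?thesis unfolding split by simp
    qed
    moreover have "\<exists>i<Suc n. d i \<noteq> 0"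
      using c by (force simp: d_def)
    ultimately show ?thesis by blast
  qed
qed

text \<open>The moment equations say that \<open>c\<close> annihilates every polynomial of degree
  below \<open>n\<close> evaluated at the nodes; the product vanishing at all nodes except
  \<open>y i\<close> isolates \<open>c i\<close>.\<close>

lemma vandermonde_system_trivial:
  fixes c y :: "nat \<Rightarrow> 'a::field"
  assumes inj: "inj_on y {..<n}" and zero: "\<And>k. k < n \<Longrightarrow> (\<Sum>i<n. c i * y i ^ k) = 0"
    and "i < n"
  shows "c i = 0"
proof -
  define p where "p = (\<Prod>j\<in>{..<n} - {i}. [:- y j, 1:])"
  have "degree p = (\<Sum>j\<in>{..<n} - {i}. degree [:- y j, 1:])"
    unfolding p_def by (rule degree_prod_eq_sum_degree) simp
  then have deg: "degree p < n" using \<open>i < n\<close> by simp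
  have "(\<Sum>j<n. c j * poly p (y j)) = (\<Sum>j<n. \<Sum>k\<le>degree p. coeff p k * (c j * y j ^ k))"
    by (simp add: poly_altdef sum_distrib_left mult_ac)
  also have "\<dots> = (\<Sum>k\<le>degree p. coeff p k * (\<Sum>j<n. c j * y j ^ k))"
    by (subst sum.swap) (simp add: sum_distrib_left)
  also have "\<dots> = 0"
    using deg by (intro sum.neutral) (auto simp: zero)
  finally have "(\<Sum>j<n. c j * poly p (y j)) = 0" .
  moreover have "(\<Sum>j<n. c j * poly p (y j)) = c i * poly p (y i)"
  proof -
    have "poly p (y j) = 0" if "j < n" "j \<noteq> i" for j
      using that by (auto simp: p_def poly_prod)
    then show ?thesis
      using \<open>i < n\<close> by (subst sum.remove[of _ i]) (auto intro!: sum.neutral)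
  qed
  moreover have "poly p (y i) \<noteq> 0"
    using inj \<open>i < n\<close> by (auto simp: p_def poly_prod inj_on_def)
  ultimately show ?thesis by simp
qed

text \<open>A product over a word \<open>x\<close> depends only on how often each letter occurs, and
  multiplicity vectors with sum \<open>s\<close> are counted by stars and bars.\<close>

lemma card_monomials_le:
  fixes G :: "'q::finite \<Rightarrow> 'i \<Rightarrow> 'a::comm_semiring_1" and s :: nat
  defines "E \<equiv> {(\<lambda>i. \<Prod>t<s. G (x t) i) | x. x \<in> {..<s} \<rightarrow>\<^sub>E UNIV}"
  shows "finite E" and "card E \<le> (s + CARD('q) - 1) choose s"
proof -
  let ?q = "CARD('q)"
  let ?L = "{l::nat list. length l = ?q \<and> sum_list l = s}"
  obtain e where e: "bij_betw e {..<?q} (UNIV :: 'q set)"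
    using ex_bij_betw_nat_finite[of "UNIV :: 'q set"] by (auto simp: atLeast0LessThan)
  have card: "card ?L = (s + ?q - 1) choose s"
    using card_length_sum_list[of ?q s] by simp
  \<comment> \<open>\<open>card\<close> is 0 on infinite sets, so finiteness of \<open>?L\<close>
    can be read off from its positive cardinality.\<close>
  have "?q > 0" by simp
  then have "s \<le> s + ?q - 1" by linarith
  then have "card ?L > 0" unfolding card by (simp only: zero_less_binomial_iff)
  then have fin: "finite ?L" by (metis card.infinite less_irrefl)
  have "E \<subseteq> (\<lambda>l i. \<Prod>j<?q. G (e j) i ^ (l ! j)) ` ?L"
  proof
    fix m assume "m \<in> E"
    then obtain x where m: "m = (\<lambda>i. \<Prod>t<s. G (x t) i)" unfolding E_def by blast
    define l where "l = map (\<lambda>j. card {t\<in>{..<s}. x t = e j}) [0..<?q]"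
    have "sum_list l = (\<Sum>j<?q. card {t\<in>{..<s}. x t = e j})"
      by (simp add: l_def interv_sum_list_conv_sum_set_nat atLeast0LessThan)
    also have "\<dots> = (\<Sum>v\<in>UNIV. card {t\<in>{..<s}. x t = v})"
      using sum.reindex_bij_betw[OF e, of "\<lambda>v. card {t\<in>{..<s}. x t = v}"] by simp
    also have "\<dots> = s"
      using sum.group[of "{..<s}" "UNIV :: 'q set" x "\<lambda>_. 1::nat"] by simp
    finally have "l \<in> ?L" by (simp add: l_def)
    moreover have "m i = (\<Prod>j<?q. G (e j) i ^ (l ! j))" for i
    proof -
      have "m i = (\<Prod>v\<in>UNIV. \<Prod>t\<in>{t\<in>{..<s}. x t = v}. G (x t) i)"
        unfolding m using prod.group[of "{..<s}" "UNIV :: 'q set" x "\<lambda>t. G (x t) i"] by simp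
      also have "\<dots> = (\<Prod>v\<in>UNIV. G v i ^ card {t\<in>{..<s}. x t = v})"
        by (intro prod.cong refl) simp
      also have "\<dots> = (\<Prod>j<?q. G (e j) i ^ card {t\<in>{..<s}. x t = e j})"
        using prod.reindex_bij_betw[OF e, of "\<lambda>v. G v i ^ card {t\<in>{..<s}. x t = v}"] by simp
      also have "\<dots> = (\<Prod>j<?q. G (e j) i ^ (l ! j))"
        by (intro prod.cong refl) (simp add: l_def)
      finally show ?thesis .
    qed
    ultimately show "m \<in> (\<lambda>l i. \<Prod>j<?q. G (e j) i ^ (l ! j)) ` ?L" by blast
  qed
  then show "finite E" "card E \<le> (s + ?q - 1) choose s"
    using finite_subset[OF _ finite_imageI[OF fin]] surj_card_le[OF fin] card by auto
qed

text \<open>Expanding over words instead of exponent vectors leaves every coefficient equal to 1, so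
  the power of a Hermitian kernel becomes a plain sum of monomials times conjugated
  monomials.\<close>

lemma power_sum_mult_expand:
  fixes f g :: "'p::finite \<Rightarrow> 'a::comm_semiring_1"
  shows "(\<Sum>l\<in>UNIV. f l * g l) ^ r =
    (\<Sum>x\<in>{..<r} \<rightarrow>\<^sub>E UNIV. (\<Prod>t<r. f (x t)) * (\<Prod>t<r. g (x t)))"
proof -
  have "(\<Sum>l\<in>UNIV. f l * g l) ^ r = (\<Prod>t<r. \<Sum>l\<in>UNIV. f l * g l)" by simp
  also have "\<dots> = (\<Sum>x\<in>{..<r} \<rightarrow>\<^sub>E UNIV. \<Prod>t<r. f (x t) * g (x t))"
    by (rule prod_sum_PiE) auto
  finally show ?thesis by (simp add: prod.distrib)
qed

text \<open>
  If the conclusion failed, some nonzero combination of \<open>r + 1\<close> evaluations would kill all monomials of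
  degree \<open>s\<close> in \<open>G\<close>, hence, by positivity of the left-hand kernel, all monomials of degree \<open>r\<close> in \<open>F\<close>.
  The monomials \<open>F l0 ^ k * F l1 ^ (r - k)\<close> turn this into a Vandermonde system.
\<close>

lemma hermitian_power_rank_bound:
  fixes F :: "'p::finite \<Rightarrow> 'z \<Rightarrow> complex" and G :: "'q::finite \<Rightarrow> 'z \<Rightarrow> complex"
  assumes eq: "\<And>z w. z \<in> X \<Longrightarrow> w \<in> X \<Longrightarrow>
      (\<Sum>l\<in>UNIV. F l z * cnj (F l w)) ^ r = \<phi> z * \<psi> w * (\<Sum>l\<in>UNIV. G l z * cnj (G l w)) ^ s"
    and one: "\<And>z. z \<in> X \<Longrightarrow> F l1 z = 1" and inf: "infinite (F l0 ` X)"
  shows "Suc r \<le> (s + CARD('q) - 1) choose s"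
proof (rule ccontr)
  assume neg: "\<not> ?thesis"
  obtain Y where Y: "finite Y" "card Y = Suc r" "Y \<subseteq> F l0 ` X"
    using infinite_arbitrarily_large[OF inf] by blast
  obtain y where y: "bij_betw y {..<Suc r} Y"
    using ex_bij_betw_nat_finite[OF Y(1)] Y(2) by (auto simp: atLeast0LessThan)
  have "\<forall>i. \<exists>z. i < Suc r \<longrightarrow> z \<in> X \<and> F l0 z = y i"
    using bij_betwE[OF y] Y(3) by (metis imageE lessThan_iff subsetD)
  from choice[OF this] obtain z where z: "\<And>i. i < Suc r \<Longrightarrow> z i \<in> X" "\<And>i. i < Suc r \<Longrightarrow> F l0 (z i) = y i"
    by blast
  define E where "E = {(\<lambda>i. \<Prod>t<s. G (x t) (z i)) | x. x \<in> {..<s} \<rightarrow>\<^sub>E (UNIV :: 'q set)}"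
  \<comment> \<open>The weights \<open>\<phi> (z i)\<close> are absorbed into the equations, whose
    number does not grow.\<close>
  define E' where "E' = (\<lambda>e i. \<phi> (z i) * e i) ` E"
  have "finite E" "card E \<le> (s + CARD('q) - 1) choose s"
    unfolding E_def using card_monomials_le[where s = s and G = "\<lambda>l i. G l (z i)"] by auto
  with neg have "finite E'" "card E' < Suc r"
    unfolding E'_def using card_image_le[of E "\<lambda>e i. \<phi> (z i) * e i"] by auto
  from homogeneous_system_nontrivial[OF this] obtain c where c: "\<exists>i<Suc r. c i \<noteq> 0"
    and zero: "\<And>e. e \<in> E' \<Longrightarrow> (\<Sum>i<Suc r. c i * e i) = 0"
    by blast
  have col: "(\<Sum>i<Suc r. c i * (\<Sum>l\<in>UNIV. F l (z i) * cnj (F l w)) ^ r) = 0" if "w \<in> X" for w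
  proof -
    have "(\<Sum>i<Suc r. c i * (\<Sum>l\<in>UNIV. F l (z i) * cnj (F l w)) ^ r) =
        (\<Sum>i<Suc r. c i * (\<phi> (z i) * \<psi> w * (\<Sum>l\<in>UNIV. G l (z i) * cnj (G l w)) ^ s))"
      by (intro sum.cong refl) (simp only: eq z(1) that lessThan_iff)
    also have "\<dots> = (\<Sum>i<Suc r. \<Sum>x\<in>{..<s} \<rightarrow>\<^sub>E UNIV.
          \<psi> w * (\<Prod>t<s. cnj (G (x t) w)) * (c i * (\<phi> (z i) * (\<Prod>t<s. G (x t) (z i)))))"
      unfolding power_sum_mult_expand sum_distrib_left by (intro sum.cong refl) (simp only: mult_ac)
    also have "\<dots> = (\<Sum>x\<in>{..<s} \<rightarrow>\<^sub>E UNIV. \<psi> w * (\<Prod>t<s. cnj (G (x t) w)) *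
          (\<Sum>i<Suc r. c i * (\<phi> (z i) * (\<Prod>t<s. G (x t) (z i)))))"
      by (subst sum.swap) (simp only: sum_distrib_left)
    also have "\<dots> = 0"
      by (intro sum.neutral ballI, subst zero) (auto simp: E'_def E_def)
    finally show ?thesis .
  qed
  define M where "M = (\<lambda>x i. \<Prod>t<r. F (x t) (z i))"
  let ?m = "\<lambda>x. \<Sum>i<Suc r. c i * M x i"
  \<comment> \<open>Positivity: pairing \<open>col\<close> at the points \<open>z j\<close> with
    \<open>cnj (c j)\<close> yields the sum of the squared moduli of all \<open>?m x\<close>, so
    each of them vanishes.\<close>
  have "(\<Sum>x\<in>{..<r} \<rightarrow>\<^sub>E UNIV. cnj (?m x) * ?m x) = (\<Sum>x\<in>{..<r} \<rightarrow>\<^sub>E UNIV.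
      \<Sum>j<Suc r. \<Sum>i<Suc r. cnj (c j * M x j) * (c i * M x i))"
    by (simp only: cnj_sum sum_product)
  also have "\<dots> = (\<Sum>j<Suc r. \<Sum>i<Suc r. \<Sum>x\<in>{..<r} \<rightarrow>\<^sub>E UNIV. cnj (c j * M x j) * (c i * M x i))"
    by (subst sum.swap, rule sum.cong[OF refl], rule sum.swap)
  also have "\<dots> = (\<Sum>j<Suc r. cnj (c j) *
      (\<Sum>i<Suc r. c i * (\<Sum>l\<in>UNIV. F l (z i) * cnj (F l (z j))) ^ r))"
    unfolding power_sum_mult_expand sum_distrib_left
    by (intro sum.cong refl) (simp add: M_def)
  also have "\<dots> = 0"
    by (intro sum.neutral ballI) (simp only: col z(1) lessThan_iff mult_zero_right)
  finally have "(\<Sum>x\<in>{..<r} \<rightarrow>\<^sub>E UNIV. complex_of_real ((cmod (?m x))\<^sup>2)) = 0"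
    by (simp only: complex_norm_square mult.commute)
  then have sq: "(\<Sum>x\<in>{..<r} \<rightarrow>\<^sub>E UNIV. (cmod (?m x))\<^sup>2) = 0"
    by (simp only: of_real_sum[symmetric] of_real_eq_0_iff)
  have m: "?m x = 0" if "x \<in> {..<r} \<rightarrow>\<^sub>E UNIV" for x
    using sum_nonneg_0[OF finite_PiE[OF finite_lessThan finite] zero_le_power2 sq that]
    by (simp only: zero_eq_power2 norm_eq_zero)
  have "c i = 0" if "i < Suc r" for i
  proof (rule vandermonde_system_trivial[where y = y, OF _ _ that])
    show "inj_on y {..<Suc r}" using y by (simp add: bij_betw_def)
    fix k assume "k < Suc r"
    \<comment> \<open>A word with \<open>k\<close> letters \<open>l0\<close> and
      \<open>r - k\<close> letters \<open>l1\<close>; as \<open>F l1\<close> is 1 on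
      \<open>X\<close>, its monomial has the value \<open>y i ^ k\<close> at
      \<open>z i\<close>.\<close>
    define x where "x = (\<lambda>t\<in>{..<r}. if t < k then l0 else l1)"
    have "(\<Prod>t<r. F (x t) (z i)) = y i ^ k" if "i < Suc r" for i
    proof -
      have "(\<Prod>t<r. F (x t) (z i)) = (\<Prod>t<r. if t < k then y i else 1)"
        using that by (intro prod.cong refl) (auto simp: x_def z one)
      also have "\<dots> = (\<Prod>t\<in>{t\<in>{..<r}. t < k}. y i)"
        by (subst prod.inter_filter) auto
      also have "{t\<in>{..<r}. t < k} = {..<k}" using \<open>k < Suc r\<close> by auto
      finally show ?thesis by simp
    qed
    then have "(\<Sum>i<Suc r. c i * y i ^ k) = ?m x"
      by (intro sum.cong refl) (simp add: M_def)
    also have "\<dots> = 0" by (rule m) (simp add: x_def)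
    finally show "(\<Sum>i<Suc r. c i * y i ^ k) = 0" .
  qed
  with c show False by blast
qed

section \<open>Polarisation and separation of variables\<close>

text \<open>The points \<open>(z, cnj z)\<close> form a totally real plane, so the identity theorem
  in one variable at a time suffices. Holomorphy of \<open>K\<close> is phrased through compositions
  to permit the linear change of variables; the halved radius keeps \<open>x + \<i> * y\<close> and
  \<open>x - \<i> * y\<close> in the original ball.\<close>

lemma polarization:
  fixes K :: "complex \<Rightarrow> complex \<Rightarrow> complex"
  assumes hol: "\<And>p q S. p holomorphic_on S \<Longrightarrow> q holomorphic_on S \<Longrightarrow>
      p ` S \<subseteq> ball 0 \<epsilon> \<Longrightarrow> q ` S \<subseteq> ball 0 \<epsilon> \<Longrightarrow> (\<lambda>x. K (p x) (q x)) holomorphic_on S"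
    and diag: "\<And>z. z \<in> ball 0 \<epsilon> \<Longrightarrow> K z (cnj z) = 0"
    and z: "z \<in> ball 0 (\<epsilon> / 2)" and w: "w \<in> ball 0 (\<epsilon> / 2)"
  shows "K z w = 0"
proof -
  let ?B = "ball (0::complex) (\<epsilon> / 2)" and ?R = "of_real ` {- (\<epsilon> / 2)<..<\<epsilon> / 2}"
  \<comment> \<open>\<open>L\<close> is holomorphic in both variables and vanishes for real arguments, where \<open>x - \<i> * y = cnj (x + \<i> * y)\<close>.\<close>
  define L where "L = (\<lambda>x y. K (x + \<i> * y) (x - \<i> * y))"
  have eps: "\<epsilon> > 0" using z norm_ge_zero[of z] by (simp add: dist_norm del: norm_ge_zero)
  have bound: "x + \<i> * y \<in> ball 0 \<epsilon>" "x - \<i> * y \<in> ball 0 \<epsilon>" if "x \<in> ?B" "y \<in> ?B" for x y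
    using that norm_triangle_ineq[of x "\<i> * y"] norm_triangle_ineq4[of x "\<i> * y"]
    by (simp_all add: norm_mult)
  have R: "?R \<subseteq> ?B" by auto
  have limpt: "0 islimpt (?R :: complex set)"
  proof (rule islimptI)
    fix T :: "complex set" assume "0 \<in> T" "open T"
    then obtain e where e: "e > 0" "ball 0 e \<subseteq> T" by (meson openE)
    let ?t = "min e \<epsilon> / 4"
    have "of_real ?t \<in> ?R \<inter> ball (0::complex) e" "complex_of_real ?t \<noteq> 0"
      using e eps by (auto simp: norm_divide simp del: of_real_divide)
    then show "\<exists>y\<in>?R. y \<in> T \<and> y \<noteq> (0::complex)" using e by blast
  qed
  have real: "L x y = 0" if "x \<in> ?R" "y \<in> ?R" for x y
  proof -
    have "cnj (x + \<i> * y) = x - \<i> * y" using that by auto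
    then show ?thesis
      unfolding L_def using diag[of "x + \<i> * y"] bound[of x y] R that by (metis subsetD)
  qed
  have hol1: "(\<lambda>x. L x y) holomorphic_on ?B" if "y \<in> ?B" for y
    unfolding L_def by (intro hol holomorphic_intros image_subsetI bound that)
  have hol2: "L x holomorphic_on ?B" if "x \<in> ?B" for x
    unfolding L_def by (intro hol holomorphic_intros image_subsetI bound that)
  have zero: "f x = 0" if "f holomorphic_on ?B" "\<And>x. x \<in> ?R \<Longrightarrow> f x = 0" "x \<in> ?B"
    for f :: "complex \<Rightarrow> complex" and x
    using eps by (intro analytic_continuation[OF that(1) open_ball connected_ball R _ limpt that(2,3)]) auto
  \<comment> \<open>First \<open>x\<close> is continued from real to complex values with
    \<open>y\<close> real, then \<open>y\<close> with \<open>x\<close> already complex.\<close>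
  have "L x y = 0" if "x \<in> ?B" "y \<in> ?R" for x y
    by (rule zero[OF hol1[OF subsetD[OF R that(2)]] real[OF _ that(2)] that(1)])
  then have zero': "L x y = 0" if "x \<in> ?B" "y \<in> ?B" for x y
    using zero[OF hol2[OF that(1)] _ that(2)] that(1) by metis
  \<comment> \<open>These values of \<open>x\<close> and \<open>y\<close> solve
    \<open>x + \<i> * y = z\<close> and \<open>x - \<i> * y = w\<close>.\<close>
  have "(z + w) / 2 \<in> ?B" "(z - w) / (2 * \<i>) \<in> ?B"
    using z w norm_triangle_ineq[of z w] norm_triangle_ineq4[of z w]
    by (simp_all add: norm_divide norm_mult)
  from zero'[OF this] show ?thesis
    by (simp add: L_def field_simps)
qed

text \<open>\<open>eq\<close> is the vanishing of the mixed derivative of r log A - s log B,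
  multiplied by the squares of \<open>A\<close> and \<open>B\<close>. The second integration is done
  on quotients of powers, so no branch of the logarithm has to be chosen.\<close>

lemma mixed_log_derivative_zero_separates:
  fixes A B :: "complex \<Rightarrow> complex \<Rightarrow> complex"
  assumes S: "convex S" "c \<in> S"
    and nz: "\<And>z w. z \<in> S \<Longrightarrow> w \<in> S \<Longrightarrow> A z w \<noteq> 0" "\<And>z w. z \<in> S \<Longrightarrow> w \<in> S \<Longrightarrow> B z w \<noteq> 0"
    and A: "\<And>z w. z \<in> S \<Longrightarrow> w \<in> S \<Longrightarrow> ((\<lambda>z. A z w) has_field_derivative A1 z w) (at z)"
      "\<And>z w. z \<in> S \<Longrightarrow> w \<in> S \<Longrightarrow> (A z has_field_derivative A2 z w) (at w)"
      "\<And>z w. z \<in> S \<Longrightarrow> w \<in> S \<Longrightarrow> ((\<lambda>z. A2 z w) has_field_derivative A12 z w) (at z)"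
    and B: "\<And>z w. z \<in> S \<Longrightarrow> w \<in> S \<Longrightarrow> ((\<lambda>z. B z w) has_field_derivative B1 z w) (at z)"
      "\<And>z w. z \<in> S \<Longrightarrow> w \<in> S \<Longrightarrow> (B z has_field_derivative B2 z w) (at w)"
      "\<And>z w. z \<in> S \<Longrightarrow> w \<in> S \<Longrightarrow> ((\<lambda>z. B2 z w) has_field_derivative B12 z w) (at z)"
    and eq: "\<And>z w. z \<in> S \<Longrightarrow> w \<in> S \<Longrightarrow>
      of_nat r * (A z w * A12 z w - A1 z w * A2 z w) * (B z w)\<^sup>2 =
      of_nat s * (B z w * B12 z w - B1 z w * B2 z w) * (A z w)\<^sup>2"
  shows "\<exists>\<phi> \<psi>. \<forall>z\<in>S. \<forall>w\<in>S. A z w ^ r = \<phi> z * \<psi> w * B z w ^ s"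
proof -
  \<comment> \<open>The derivative in \<open>w\<close> of r log A - s log B.\<close>
  define q where "q = (\<lambda>z w. of_nat r * (A2 z w / A z w) - of_nat s * (B2 z w / B z w))"
  have q: "q z w = q c w" if "z \<in> S" "w \<in> S" for z w
  proof -
    have der: "((\<lambda>z. q z w) has_field_derivative 0) (at z)" if "z \<in> S" for z
    proof -
      note nz = nz[OF that \<open>w \<in> S\<close>]
      have "((\<lambda>z. q z w) has_field_derivative
          of_nat r * ((A12 z w * A z w - A2 z w * A1 z w) / (A z w * A z w)) -
          of_nat s * ((B12 z w * B z w - B2 z w * B1 z w) / (B z w * B z w))) (at z)"
        unfolding q_def using that \<open>w \<in> S\<close> nz
        by (intro DERIV_diff DERIV_cmult DERIV_divide A B)
      moreover have "of_nat r * (A12 z w * A z w - A2 z w * A1 z w) / (A z w * A z w) =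
          of_nat s * (B12 z w * B z w - B2 z w * B1 z w) / (B z w * B z w)"
        by (subst frac_eq_eq) (use nz in simp, use nz in simp, use eq[OF that \<open>w \<in> S\<close>] in algebra)
      ultimately show ?thesis by simp
    qed
    then obtain k where "\<forall>z\<in>S. q z w = k"
      using has_field_derivative_zero_constant[OF S(1) has_field_derivative_at_within[OF der]] by blast
    then show ?thesis using S(2) that by simp
  qed
  \<comment> \<open>\<open>pow\<close> and \<open>quot\<close> keep each derivative as the function
    times its logarithmic derivative: exponents become factors and quotients become
    differences.\<close>
  have pow: "((\<lambda>w. f w ^ n) has_field_derivative f w ^ n * (of_nat n * (f' / f w))) (at w)"
    if "(f has_field_derivative f') (at w)" "f w \<noteq> 0" for f :: "complex \<Rightarrow> complex" and f' w n
    by (rule DERIV_cong[OF DERIV_power[OF that(1)]]) (use that(2) in \<open>cases n; simp\<close>)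
  have quot: "((\<lambda>w. f w / g w) has_field_derivative f w / g w * (d - e)) (at w)"
    if "(f has_field_derivative f w * d) (at w)" "(g has_field_derivative g w * e) (at w)" "g w \<noteq> 0"
    for f g :: "complex \<Rightarrow> complex" and d e w
    by (rule DERIV_cong[OF DERIV_divide[OF that]]) (use that(3) in \<open>simp add: field_simps\<close>)
  \<comment> \<open>Dividing by the value at the base point \<open>c\<close> turns the logarithmic
    derivative in \<open>w\<close> into \<open>q z w - q c w\<close>, which is 0.\<close>
  define Q where "Q = (\<lambda>z w. (A z w ^ r / B z w ^ s) / (A c w ^ r / B c w ^ s))"
  have Q: "Q z w = Q z c" if "z \<in> S" "w \<in> S" for z w
  proof -
    have der: "(Q z has_field_derivative 0) (at w)" if "w \<in> S" for w
    proof -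
      have quot_q: "((\<lambda>w. A x w ^ r / B x w ^ s) has_field_derivative A x w ^ r / B x w ^ s * q x w) (at w)"
        if "x \<in> S" for x
        unfolding q_def using that \<open>w \<in> S\<close> nz
        by (intro quot[where f = "\<lambda>w. A x w ^ r" and g = "\<lambda>w. B x w ^ s"] pow A B) simp_all
      have "(Q z has_field_derivative Q z w * (q z w - q c w)) (at w)"
        unfolding Q_def
        by (rule quot[where f = "\<lambda>w. A z w ^ r / B z w ^ s" and g = "\<lambda>w. A c w ^ r / B c w ^ s",
              OF quot_q quot_q]) (use \<open>z \<in> S\<close> \<open>w \<in> S\<close> S(2) nz in simp_all)
      then show ?thesis using q[OF \<open>z \<in> S\<close> that] by simp
    qed
    then obtain k where "\<forall>w\<in>S. Q z w = k"
      using has_field_derivative_zero_constant[OF S(1) has_field_derivative_at_within[OF der]] by blast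
    then show ?thesis using S(2) that by simp
  qed
  have "A z w ^ r = Q z c * (A c w ^ r / B c w ^ s) * B z w ^ s" if "z \<in> S" "w \<in> S" for z w
    unfolding Q[OF that, symmetric] using nz S(2) that by (simp add: Q_def)
  then show ?thesis
    by (intro exI[of _ "\<lambda>z. Q z c"] exI[of _ "\<lambda>w. A c w ^ r / B c w ^ s"]) simp
qed

text \<open>\<open>eq\<close> compares, on the diagonal, the mixed derivatives of the logarithms of
  two Hermitian kernels; polarisation extends it to independent variables, where it can be
  integrated. \<open>K\<close> and \<open>L\<close> are one formula, given twice because the index
  types differ.\<close>

lemma hermitian_kernel_powers_separate:
  fixes F :: "'p::finite \<Rightarrow> complex \<Rightarrow> complex" and G :: "'q::finite \<Rightarrow> complex \<Rightarrow> complex"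
  defines "K \<equiv> (\<lambda>H1 H2 z. \<Sum>l\<in>UNIV. H1 l z * cnj (H2 l z))"
    and "L \<equiv> (\<lambda>H1 H2 z. \<Sum>l\<in>UNIV. H1 l z * cnj (H2 l z))"
  assumes eps: "\<epsilon> > 0"
    and F: "\<And>l. F l holomorphic_on ball 0 \<epsilon>" and G: "\<And>l. G l holomorphic_on ball 0 \<epsilon>"
    and nz: "K F F 0 \<noteq> 0" "L G G 0 \<noteq> 0"
    and eq: "\<And>z. z \<in> ball 0 \<epsilon> \<Longrightarrow>
      of_nat r * (K F F z * K (\<lambda>l. deriv (F l)) (\<lambda>l. deriv (F l)) z -
        K (\<lambda>l. deriv (F l)) F z * K F (\<lambda>l. deriv (F l)) z) * (L G G z)\<^sup>2 =
      of_nat s * (L G G z * L (\<lambda>l. deriv (G l)) (\<lambda>l. deriv (G l)) z -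
        L (\<lambda>l. deriv (G l)) G z * L G (\<lambda>l. deriv (G l)) z) * (K F F z)\<^sup>2"
  shows "\<exists>\<delta> \<phi> \<psi>. 0 < \<delta> \<and> \<delta> \<le> \<epsilon> \<and> (\<forall>z\<in>ball 0 \<delta>. \<forall>w\<in>ball 0 \<delta>.
      (\<Sum>l\<in>UNIV. F l z * cnj (F l w)) ^ r = \<phi> z * \<psi> w * (\<Sum>l\<in>UNIV. G l z * cnj (G l w)) ^ s)"
proof -
  let ?dF = "\<lambda>l. deriv (F l)" and ?dG = "\<lambda>l. deriv (G l)"
  \<comment> \<open>Conjugating both inside and outside \<open>H2\<close> makes the kernels
    holomorphic in \<open>w\<close>; the Hermitian kernels reappear at \<open>cnj w\<close>.\<close>
  define A where "A = (\<lambda>(H1 :: 'p \<Rightarrow> complex \<Rightarrow> complex) H2 z w. \<Sum>l\<in>UNIV. H1 l z * cnj (H2 l (cnj w)))"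
  define B where "B = (\<lambda>(H1 :: 'q \<Rightarrow> complex \<Rightarrow> complex) H2 z w. \<Sum>l\<in>UNIV. H1 l z * cnj (H2 l (cnj w)))"
  have dF: "(F l has_field_derivative ?dF l z) (at z)" "(?dF l has_field_derivative deriv (?dF l) z) (at z)"
    and dG: "(G k has_field_derivative ?dG k z) (at z)" "(?dG k has_field_derivative deriv (?dG k) z) (at z)"
    if "z \<in> ball 0 \<epsilon>" for z l k
    using that F G by (auto intro!: holomorphic_derivI[of _ "ball 0 \<epsilon>"] holomorphic_deriv)
  note cnj_cnj = has_field_derivative_cnj_cnj[unfolded o_def]
  note dFc = cnj_cnj[OF dF(1)] cnj_cnj[OF dF(2)] and dGc = cnj_cnj[OF dG(1)] cnj_cnj[OF dG(2)]
  have hF: "?dF l holomorphic_on ball 0 \<epsilon>" for l using F by (intro holomorphic_intros) auto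
  have hG: "?dG l holomorphic_on ball 0 \<epsilon>" for l using G by (intro holomorphic_intros) auto
  have holc: "(\<lambda>w. cnj (f (cnj w))) holomorphic_on ball 0 \<epsilon>" if "f holomorphic_on ball 0 \<epsilon>" for f :: "complex \<Rightarrow> complex"
  proof (rule holomorphic_onI)
    fix w :: complex assume "w \<in> ball 0 \<epsilon>"
    then have "(f has_field_derivative deriv f (cnj w)) (at (cnj w))"
      using that by (intro holomorphic_derivI[of _ "ball 0 \<epsilon>"]) auto
    then show "(\<lambda>w. cnj (f (cnj w))) field_differentiable at w within ball 0 \<epsilon>"
      by (metis cnj_cnj field_differentiable_def field_differentiable_at_within)
  qed
  have comp: "(\<lambda>x. f (p x)) holomorphic_on S"
    if "f holomorphic_on ball 0 \<epsilon>" "p holomorphic_on S" "p ` S \<subseteq> ball 0 \<epsilon>" for f p :: "complex \<Rightarrow> complex" and S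
    using holomorphic_on_compose_gen[OF that(2,1)] that(3) by (auto simp: o_def)
  have sep: "of_nat r * (A F F z w * A ?dF ?dF z w - A ?dF F z w * A F ?dF z w) * (B G G z w)\<^sup>2 =
      of_nat s * (B G G z w * B ?dG ?dG z w - B ?dG G z w * B G ?dG z w) * (A F F z w)\<^sup>2"
    if "z \<in> ball 0 (\<epsilon> / 2)" "w \<in> ball 0 (\<epsilon> / 2)" for z w
  proof -
    have hol: "(\<lambda>x. A H1 H2 (p x) (q x)) holomorphic_on S"
      if "p holomorphic_on S" "q holomorphic_on S" "p ` S \<subseteq> ball 0 \<epsilon>" "q ` S \<subseteq> ball 0 \<epsilon>"
        "\<And>l. H1 l holomorphic_on ball 0 \<epsilon>" "\<And>l. H2 l holomorphic_on ball 0 \<epsilon>" for p q S H1 H2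
      unfolding A_def using comp[OF that(5) that(1,3)] comp[OF holc[OF that(6)] that(2,4)]
      by (intro holomorphic_intros)
    have hol': "(\<lambda>x. B H1 H2 (p x) (q x)) holomorphic_on S"
      if "p holomorphic_on S" "q holomorphic_on S" "p ` S \<subseteq> ball 0 \<epsilon>" "q ` S \<subseteq> ball 0 \<epsilon>"
        "\<And>l. H1 l holomorphic_on ball 0 \<epsilon>" "\<And>l. H2 l holomorphic_on ball 0 \<epsilon>" for p q S H1 H2
      unfolding B_def using comp[OF that(5) that(1,3)] comp[OF holc[OF that(6)] that(2,4)]
      by (intro holomorphic_intros)
    \<comment> \<open>The difference of the two sides in independent variables; at
      \<open>w = cnj z\<close> it vanishes by \<open>eq\<close>.\<close>
    define D where "D = (\<lambda>z w.
      of_nat r * (A F F z w * A ?dF ?dF z w - A ?dF F z w * A F ?dF z w) * (B G G z w)\<^sup>2 -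
      of_nat s * (B G G z w * B ?dG ?dG z w - B ?dG G z w * B G ?dG z w) * (A F F z w)\<^sup>2)"
    have "D z w = 0"
    proof (rule polarization[where K = D, OF _ _ that])
      show "(\<lambda>x. D (p x) (q x)) holomorphic_on S"
        if "p holomorphic_on S" "q holomorphic_on S" "p ` S \<subseteq> ball 0 \<epsilon>" "q ` S \<subseteq> ball 0 \<epsilon>" for p q S
        unfolding D_def by (intro holomorphic_intros hol hol' that F G hF hG)
      show "D z (cnj z) = 0" if "z \<in> ball 0 \<epsilon>" for z
        using eq[OF that] by (simp add: D_def A_def B_def K_def L_def)
    qed
    then show ?thesis by (simp add: D_def)
  qed
  have "continuous_on (ball 0 \<epsilon> \<times> ball 0 \<epsilon>) (\<lambda>x. A F F (fst x) (snd x))"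
    "continuous_on (ball 0 \<epsilon> \<times> ball 0 \<epsilon>) (\<lambda>x. B G G (fst x) (snd x))"
    unfolding A_def B_def
    by (intro continuous_intros continuous_on_compose2[OF holomorphic_on_imp_continuous_on[OF F]]
        continuous_on_compose2[OF holomorphic_on_imp_continuous_on[OF G]]; auto)+
  then have cont: "isCont (\<lambda>x. A F F (fst x) (snd x)) (0, 0)" "isCont (\<lambda>x. B G G (fst x) (snd x)) (0, 0)"
    using eps by (auto simp: continuous_on_eq_continuous_at open_Times)
  have nz': "A F F 0 0 \<noteq> 0" "B G G 0 0 \<noteq> 0"
    using nz by (auto simp: A_def B_def K_def L_def)
  obtain e1 where e1: "e1 > 0" "\<And>x. dist (0, 0) x < e1 \<Longrightarrow> A F F (fst x) (snd x) \<noteq> 0"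
    using continuous_at_avoid[OF cont(1), of 0] nz'(1) by auto
  obtain e2 where e2: "e2 > 0" "\<And>x. dist (0, 0) x < e2 \<Longrightarrow> B G G (fst x) (snd x) \<noteq> 0"
    using continuous_at_avoid[OF cont(2), of 0] nz'(2) by auto
  define e where "e = min e1 e2"
  \<comment> \<open>\<open>e / 2\<close> because the norm of a pair is at most the sum of the norms,
    \<open>\<epsilon> / 2\<close> because \<open>sep\<close> holds on that radius.\<close>
  define \<delta> where "\<delta> = min (e / 2) (\<epsilon> / 2)"
  have ne: "A F F z w \<noteq> 0" "B G G z w \<noteq> 0" if "z \<in> ball 0 \<delta>" "w \<in> ball 0 \<delta>" for z w
  proof -
    have "dist (0, 0) (z, w) < e"
      using norm_Pair_le[of "- z" "- w"] that by (simp add: \<delta>_def dist_norm flip: zero_prod_def)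
    then show "A F F z w \<noteq> 0" "B G G z w \<noteq> 0"
      using e1(2)[of "(z, w)"] e2(2)[of "(z, w)"] by (simp_all add: e_def)
  qed
  have \<delta>: "0 < \<delta>" "\<delta> \<le> \<epsilon>" "\<delta> \<le> \<epsilon> / 2" using e1(1) e2(1) eps by (auto simp: \<delta>_def e_def)
  have "\<exists>\<phi> \<psi>. \<forall>z\<in>ball 0 \<delta>. \<forall>w\<in>ball 0 \<delta>. A F F z w ^ r = \<phi> z * \<psi> w * B G G z w ^ s"
  proof (rule mixed_log_derivative_zero_separates[where c = 0 and ?A1.0 = "A ?dF F" and ?A2.0 = "A F ?dF"
        and ?A12.0 = "A ?dF ?dF" and ?B1.0 = "B ?dG G" and ?B2.0 = "B G ?dG" and ?B12.0 = "B ?dG ?dG"])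
    fix z w :: complex assume zw: "z \<in> ball 0 \<delta>" "w \<in> ball 0 \<delta>"
    then have zw': "z \<in> ball 0 \<epsilon>" "cnj w \<in> ball 0 \<epsilon>" using \<delta> by auto
    show "((\<lambda>z. A F F z w) has_field_derivative A ?dF F z w) (at z)"
      "(A F F z has_field_derivative A F ?dF z w) (at w)"
      "((\<lambda>z. A F ?dF z w) has_field_derivative A ?dF ?dF z w) (at z)"
      unfolding A_def by (intro DERIV_sum DERIV_cmult DERIV_cmult_right dF dFc zw')+
    show "((\<lambda>z. B G G z w) has_field_derivative B ?dG G z w) (at z)"
      "(B G G z has_field_derivative B G ?dG z w) (at w)"
      "((\<lambda>z. B G ?dG z w) has_field_derivative B ?dG ?dG z w) (at z)"
      unfolding B_def by (intro DERIV_sum DERIV_cmult DERIV_cmult_right dG dGc zw')+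
  qed (use \<delta> ne sep in auto)
  then obtain \<phi> \<psi> where sol: "\<And>z w. z \<in> ball 0 \<delta> \<Longrightarrow> w \<in> ball 0 \<delta> \<Longrightarrow>
      A F F z w ^ r = \<phi> z * \<psi> w * B G G z w ^ s" by blast
  have "(\<Sum>l\<in>UNIV. F l z * cnj (F l w)) ^ r =
      \<phi> z * \<psi> (cnj w) * (\<Sum>l\<in>UNIV. G l z * cnj (G l w)) ^ s"
    if "z \<in> ball 0 \<delta>" "w \<in> ball 0 \<delta>" for z w
    using sol[of z "cnj w"] that by (simp add: A_def B_def)
  with \<delta> show ?thesis
    by (intro exI[of _ \<delta>] exI[of _ \<phi>] exI[of _ "\<lambda>w. \<psi> (cnj w)"]) simp
qed

section \<open>Curves in Fubini-Study spaces\<close>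

lemma fs_potential_inner: "fs_potential b Z = 1 / b * ln (1 + b * (Z \<bullet> Z))"
  by (simp add: fs_potential_def inner_vec_def dot_square_norm)

lemma wirtinger_bar_fs_potential:
  fixes z :: "complex^'n"
  assumes "b > 0"
  shows "wirtinger_bar j (\<lambda>w. complex_of_real (fs_potential b w)) z =
    z $ j / complex_of_real (1 + b * (z \<bullet> z))"
proof -
  define P where "P = 1 + b * (z \<bullet> z)"
  have pos: "1 + b * (z \<bullet> z) > 0" using assms by (simp add: add_pos_nonneg)
  have "(fs_potential b has_derivative (\<lambda>v. 1 / b * (b * (z \<bullet> v + v \<bullet> z) / (1 + b * (z \<bullet> z))))) (at z)"
    unfolding fs_potential_inner using pos assms
    by (auto intro!: derivative_eq_intros simp: divide_inverse mult_ac)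
  also have "(\<lambda>v. 1 / b * (b * (z \<bullet> v + v \<bullet> z) / (1 + b * (z \<bullet> z)))) = (\<lambda>v. 2 * (z \<bullet> v) / (1 + b * (z \<bullet> z)))"
    using assms by (simp add: inner_commute)
  finally have "((\<lambda>w. complex_of_real (fs_potential b w)) has_derivative
      (\<lambda>v. complex_of_real (2 * (z \<bullet> v) / (1 + b * (z \<bullet> z))))) (at z)"
    by (rule has_derivative_of_real)
  from frechet_derivative_at[OF this, symmetric] show ?thesis
    unfolding wirtinger_bar_def P_def[symmetric] by (simp add: inner_axis complex_eq_iff field_simps)
qed

text \<open>The formula for \<open>wirtinger_bar\<close> holds at every point and can therefore be
  rewritten under the outer derivative; the quotient rule then gives a diagonal part and a rank-one
  correction.\<close>

lemma levi_matrix_fs_potential: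
  fixes z :: "complex^'n"
  assumes "b > 0"
  shows "levi_matrix (fs_potential b) z i j =
    (if i = j then 1 else 0) / complex_of_real (1 + b * (z \<bullet> z)) -
    complex_of_real b * z $ j * cnj (z $ i) / (complex_of_real (1 + b * (z \<bullet> z)))\<^sup>2"
proof -
  let ?P = "1 + b * (z \<bullet> z)"
  have pos: "?P > 0" using assms by (simp add: add_pos_nonneg)
  then have nz: "complex_of_real ?P \<noteq> 0" by (metis less_irrefl of_real_eq_0_iff)
  have "((\<lambda>w. complex_of_real (1 + b * (w \<bullet> w))) has_derivative
      (\<lambda>v. complex_of_real (2 * b * (z \<bullet> v)))) (at z)"
    by (auto intro!: derivative_eq_intros simp: inner_commute algebra_simps)
  from has_derivative_divide'[OF _ this nz, of "\<lambda>w. w $ j" "\<lambda>v. v $ j"]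
  have "((\<lambda>w. w $ j / complex_of_real (1 + b * (w \<bullet> w))) has_derivative
      (\<lambda>v. (v $ j * complex_of_real ?P - z $ j * complex_of_real (2 * b * (z \<bullet> v))) /
        (complex_of_real ?P * complex_of_real ?P))) (at z)"
    by (simp add: bounded_linear_imp_has_derivative bounded_linear_vec_nth)
  from frechet_derivative_at[OF this, symmetric]
  have "levi_matrix (fs_potential b) z i j =
      ((axis i 1 $ j - \<i> * axis i \<i> $ j) * complex_of_real ?P -
        z $ j * (complex_of_real (2 * b * Re (z $ i)) - \<i> * complex_of_real (2 * b * Im (z $ i)))) /
      (complex_of_real ?P * complex_of_real ?P) / 2"
    unfolding levi_matrix_def wirtinger_def wirtinger_bar_fs_potential[OF assms]
    by (simp add: inner_axis inner_complex_def algebra_simps add_divide_distrib diff_divide_distrib)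
  also have "axis i 1 $ j - \<i> * axis i \<i> $ j = (if i = j then 2 else (0::complex))"
    by (simp add: axis_def)
  also have "complex_of_real (2 * b * Re (z $ i)) - \<i> * complex_of_real (2 * b * Im (z $ i)) =
      2 * complex_of_real b * cnj (z $ i)"
    by (simp add: complex_eq_iff)
  also have "((if i = j then 2 else 0) * complex_of_real ?P - z $ j * (2 * complex_of_real b * cnj (z $ i))) /
      (complex_of_real ?P * complex_of_real ?P) / 2 =
      (if i = j then 1 else 0) * complex_of_real ?P / (complex_of_real ?P * complex_of_real ?P) -
      complex_of_real b * z $ j * cnj (z $ i) / (complex_of_real ?P * complex_of_real ?P)"
    by (simp add: diff_divide_distrib mult_ac del: of_real_add of_real_mult)
  finally show ?thesis
    using nz by (simp add: power2_eq_square del: of_real_add of_real_mult)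
qed

text \<open>Clearing the denominators leaves a polynomial identity, convenient for the algebra with
  curves.\<close>

lemma kahler_metric_fs_potential:
  fixes z u :: "complex^'n"
  assumes "b > 0"
  shows "complex_of_real (kahler_metric (fs_potential b) z u u) * (1 + b * (\<Sum>i\<in>UNIV. z $ i * cnj (z $ i)))\<^sup>2 =
    2 * ((1 + b * (\<Sum>i\<in>UNIV. z $ i * cnj (z $ i))) * (\<Sum>i\<in>UNIV. u $ i * cnj (u $ i)) -
      b * (\<Sum>i\<in>UNIV. u $ i * cnj (z $ i)) * (\<Sum>i\<in>UNIV. z $ i * cnj (u $ i)))"
proof -
  define P where "P = 1 + b * (z \<bullet> z)"
  have pos: "P > 0" unfolding P_def using assms by (simp add: add_pos_nonneg)
  define c where "c = (\<Sum>i\<in>UNIV. u $ i * cnj (z $ i))"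
  have norm: "(\<Sum>i\<in>UNIV. x $ i * cnj (x $ i)) = complex_of_real (x \<bullet> x)" for x :: "complex^'n"
    by (simp add: inner_vec_def dot_square_norm complex_norm_square[symmetric] del: of_real_power)
  have P: "1 + complex_of_real b * (\<Sum>i\<in>UNIV. z $ i * cnj (z $ i)) = complex_of_real P"
    unfolding norm P_def by simp
  have cnj_c: "(\<Sum>i\<in>UNIV. z $ i * cnj (u $ i)) = cnj c"
    by (simp add: c_def mult.commute)
  define g where "g = levi_matrix (fs_potential b) z"
  have "kahler_metric (fs_potential b) z u u = 2 * Re (\<Sum>i\<in>UNIV. \<Sum>j\<in>UNIV. g i j * (u $ i * cnj (u $ j)))"
  proof -
    \<comment> \<open>For the second vector \<open>\<i> *s u\<close> the two terms of the form
      coincide, which is the origin of the factor 2.\<close>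
    have "(\<Sum>i\<in>UNIV. \<Sum>j\<in>UNIV. g i j * (u $ i * cnj ((\<i> *s u) $ j) - (\<i> *s u) $ i * cnj (u $ j))) =
        - 2 * \<i> * (\<Sum>i\<in>UNIV. \<Sum>j\<in>UNIV. g i j * (u $ i * cnj (u $ j)))"
      unfolding sum_distrib_left by (intro sum.cong refl) (simp add: algebra_simps)
    then show ?thesis unfolding kahler_metric_def kahler_form_def g_def[symmetric] by simp
  qed
  also have "(\<Sum>i\<in>UNIV. \<Sum>j\<in>UNIV. g i j * (u $ i * cnj (u $ j))) =
      (\<Sum>i\<in>UNIV. \<Sum>j\<in>UNIV. (if i = j then u $ i * cnj (u $ i) / P else 0) -
        b / P\<^sup>2 * ((u $ i * cnj (z $ i)) * (z $ j * cnj (u $ j))))"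
    unfolding g_def levi_matrix_fs_potential[OF assms] P_def[symmetric]
    by (intro sum.cong refl) (simp add: algebra_simps)
  also have "\<dots> = (\<Sum>i\<in>UNIV. u $ i * cnj (u $ i)) / P - b / P\<^sup>2 * (c * cnj c)"
    unfolding sum_subtractf c_def cnj_c[unfolded c_def, symmetric] sum_product
    by (simp add: sum_distrib_left sum_divide_distrib)
  also have "\<dots> = complex_of_real ((u \<bullet> u) / P - b / P\<^sup>2 * (cmod c)\<^sup>2)"
    unfolding norm by (simp add: complex_norm_square del: of_real_power)
  finally have "kahler_metric (fs_potential b) z u u = 2 * ((u \<bullet> u) / P - b / P\<^sup>2 * (cmod c)\<^sup>2)"
    by (simp only: Re_complex_of_real)
  then have "kahler_metric (fs_potential b) z u u * P\<^sup>2 = 2 * (P * (u \<bullet> u) - b * (cmod c)\<^sup>2)"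
    using pos by (simp add: field_simps power2_eq_square)
  then have "complex_of_real (kahler_metric (fs_potential b) z u u * P\<^sup>2) =
      complex_of_real (2 * (P * (u \<bullet> u) - b * (cmod c)\<^sup>2))"
    by (simp only:)
  then show ?thesis
    unfolding P unfolding cnj_c c_def[symmetric] norm
    by (simp add: complex_norm_square mult.assoc flip: of_real_power) 
qed

section \<open>Complex curves in submanifolds and a common curve of relatives\<close>

lemma bounded_linear_complex_scaling: "bounded_linear (\<lambda>t::complex. t *s (v :: complex^'n))"
proof -
  have "linear (\<lambda>t::complex. t *s v)"
    by (rule linearI) (simp_all add: vec_eq_iff algebra_simps)
  then show ?thesis by (simp add: linear_conv_bounded_linear)
qed

lemma complex_curve_component_derivative:
  fixes \<sigma> :: "complex \<Rightarrow> complex^'n"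
  assumes "(\<sigma> has_derivative (\<lambda>t. t *s u)) (at \<zeta>)"
  shows "((\<lambda>\<zeta>. \<sigma> \<zeta> $ i) has_field_derivative u $ i) (at \<zeta>)"
  using bounded_linear.has_derivative[OF bounded_linear_vec_nth[of i] assms]
  by (simp add: has_field_derivative_def mult_commute_abs)

text \<open>Complex homogeneity of the derivative of \<open>h\<close> lets a single velocity vector
  describe the image curve as well.\<close>

lemma holomorphic_map_comp_complex_curve:
  fixes \<sigma> :: "complex \<Rightarrow> complex^'n" and h :: "complex^'n \<Rightarrow> complex^'m"
  assumes "holomorphic_map h V" "\<sigma> \<zeta> \<in> V" and \<sigma>: "(\<sigma> has_derivative (\<lambda>t. t *s u)) (at \<zeta>)"
  shows "((\<lambda>\<zeta>. h (\<sigma> \<zeta>)) has_derivative (\<lambda>t. t *s frechet_derivative h (at (\<sigma> \<zeta>)) u)) (at \<zeta>)"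
proof -
  obtain h' where h': "(h has_derivative h') (at (\<sigma> \<zeta>))" and lin: "\<And>c v. h' (c *s v) = c *s h' v"
    using assms(1,2) unfolding holomorphic_map_def by blast
  show ?thesis
    using diff_chain_at[OF \<sigma> h'] by (simp add: o_def lin flip: frechet_derivative_at[OF h'])
qed

text \<open>Restricting the parameter to the real line through \<open>\<zeta>\<close> gives the real
  curve that \<open>tangent_space\<close> asks for.\<close>

lemma complex_curve_tangent:
  fixes \<sigma> :: "complex \<Rightarrow> complex^'n"
  assumes \<sigma>: "(\<sigma> has_derivative (\<lambda>t. t *s u)) (at \<zeta>)" and "open D" "\<zeta> \<in> D" "\<sigma> ` D \<subseteq> X"
  shows "u \<in> tangent_space X (\<sigma> \<zeta>)"
proof -
  let ?l = "\<lambda>t::real. \<zeta> + complex_of_real t"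
  have l: "(?l has_derivative complex_of_real) (at 0)"
    by (auto intro!: derivative_eq_intros)
  have "(\<sigma> has_derivative (\<lambda>t. t *s u)) (at (?l 0))" using \<sigma> by simp
  from diff_chain_at[OF l this]
  have "((\<lambda>t. \<sigma> (?l t)) has_vector_derivative u) (at 0)"
    unfolding has_vector_derivative_def o_def
    by (rule has_derivative_eq_rhs) (simp add: fun_eq_iff vec_eq_iff, simp add: scaleR_conv_of_real)
  moreover have "\<forall>\<^sub>F t in at 0. \<sigma> (?l t) \<in> X"
  proof -
    have "(?l \<longlongrightarrow> \<zeta>) (at 0)" by (auto intro!: tendsto_eq_intros)
    then have "\<forall>\<^sub>F t in at 0. ?l t \<in> D"
      using \<open>open D\<close> \<open>\<zeta> \<in> D\<close> by (rule topological_tendstoD)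
    then show ?thesis by eventually_elim (use assms(4) in blast)
  qed
  ultimately show ?thesis
    unfolding tangent_space_def by (intro CollectI exI[of _ "\<lambda>t. \<sigma> (?l t)"]) auto
qed

text \<open>In straightening coordinates the submanifold contains a piece of a complex line; its
  preimage is \<open>f\<close>, and \<open>g\<close> is the image of \<open>f\<close> under the
  isometry, read in the other space. All charts of a space carry the same potential, so the choice
  of charts leaves no trace in the conclusion. Injectivity of both curves allows either to supply
  independent powers later.\<close>

lemma fubini_study_relatives_common_curve:
  assumes pos: "0 < b" "0 < a"
    and rel: "relatives (fubini_study TYPE('n::finite) b) (fubini_study TYPE('m::finite) a)"
  shows "\<exists>\<epsilon> (f :: complex \<Rightarrow> complex^'n) (g :: complex \<Rightarrow> complex^'m). 0 < \<epsilon> \<and>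
    (\<forall>i. (\<lambda>\<zeta>. f \<zeta> $ i) holomorphic_on ball 0 \<epsilon>) \<and> (\<forall>k. (\<lambda>\<zeta>. g \<zeta> $ k) holomorphic_on ball 0 \<epsilon>) \<and>
    inj_on f (ball 0 \<epsilon>) \<and> inj_on g (ball 0 \<epsilon>) \<and>
    (\<forall>\<zeta>\<in>ball 0 \<epsilon>.
      kahler_metric (fs_potential a) (g \<zeta>) (\<chi> k. deriv (\<lambda>\<zeta>. g \<zeta> $ k) \<zeta>) (\<chi> k. deriv (\<lambda>\<zeta>. g \<zeta> $ k) \<zeta>) =
      kahler_metric (fs_potential b) (f \<zeta>) (\<chi> i. deriv (\<lambda>\<zeta>. f \<zeta> $ i) \<zeta>) (\<chi> i. deriv (\<lambda>\<zeta>. f \<zeta> $ i) \<zeta>))"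
proof -
  let ?M = "fubini_study TYPE('n) b" and ?N = "fubini_study TYPE('m) a"
  obtain k l S T \<phi> where k: "k \<ge> 1" and S: "complex_submanifold ?M k S" and T: "complex_submanifold ?N l T"
    and iso: "biholomorphic_isometry ?M S ?N T \<phi>"
    using rel unfolding relatives_def by blast
  have bij: "bij_betw \<phi> S T" and hol: "holomorphic_between ?M S ?N \<phi>" and isom: "isometric_on ?M S ?N \<phi>"
    using iso unfolding biholomorphic_isometry_def by auto
  obtain p where "p \<in> S" using S unfolding complex_submanifold_def by blast
  then have "\<exists>c\<in>?M. \<exists>V W (F :: complex^'n \<Rightarrow> complex^'n) I.
      V \<subseteq> chart_dom c \<and> p \<in> param c ` V \<and> biholomorphic_map F V W \<and> card I = k \<and>
      F ` (V \<inter> in_chart c S) = {w \<in> W. \<forall>i. i \<notin> I \<longrightarrow> w $ i = 0}"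
    using S unfolding complex_submanifold_def by blast
  then obtain c V W and F :: "complex^'n \<Rightarrow> complex^'n" and I where c: "c \<in> ?M" and V: "V \<subseteq> chart_dom c"
    and p: "p \<in> param c ` V" and F: "biholomorphic_map F V W" and I: "card I = k"
    and plane: "F ` (V \<inter> in_chart c S) = {w \<in> W. \<forall>i. i \<notin> I \<longrightarrow> w $ i = 0}"
    by blast
  from p obtain z0 where z0: "z0 \<in> V" "p = param c z0" by blast
  with V \<open>p \<in> S\<close> have z0S: "z0 \<in> V \<inter> in_chart c S" by (auto simp: in_chart_def)
  have "\<phi> p \<in> T" using bij \<open>p \<in> S\<close> by (rule bij_betwE[THEN bspec])
  then have "\<phi> p \<in> points ?N" using T unfolding complex_submanifold_def by blast
  then obtain d where d: "d \<in> ?N" "\<phi> p \<in> param d ` chart_dom d" unfolding points_def by blast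
  have "\<exists>U h. local_rep c d S \<phi> z0 U h"
    using hol c d z0S z0(2) unfolding holomorphic_between_def by blast
  then obtain U h where rep: "local_rep c d S \<phi> z0 U h" by blast
  then have U: "open U" "z0 \<in> U" and h: "holomorphic_map h U"
    and \<phi>: "\<And>w. w \<in> U \<inter> in_chart c S \<Longrightarrow> \<phi> (param c w) = param d (h w)"
    unfolding local_rep_def holomorphic_map_def by blast+
  have charts: "inj (param c)" "potential c = fs_potential b" "potential d = fs_potential a"
    using c d pos inj_param_fs_chart by (auto simp: fubini_study_def fs_chart_def)
  define G where "G = inv_into V F"
  have bijF: "bij_betw F V W" and holG: "holomorphic_map G W"
    using F unfolding biholomorphic_map_def G_def by auto
  have openW: "open W" using holG unfolding holomorphic_map_def by blast
  have GF: "G (F z) = z" if "z \<in> V" for z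
    using bijF that by (simp add: G_def bij_betw_def)
  have FG: "F (G w) = w" if "w \<in> W" for w
    using bijF that by (metis G_def bij_betw_inv_into_right)
  from I k have "I \<noteq> {}" by auto
  then obtain i0 where i0: "i0 \<in> I" by blast
  \<comment> \<open>A line through \<open>F z0\<close> in a direction which the coordinate plane
    leaves free; such an \<open>i0\<close> exists because \<open>k \<ge> 1\<close>.\<close>
  define L where "L = (\<lambda>\<zeta>. F z0 + \<zeta> *s axis i0 (1::complex))"
  have L: "(L has_derivative (\<lambda>t. t *s axis i0 1)) (at \<zeta>)" for \<zeta>
    unfolding L_def
    by (auto intro!: derivative_eq_intros bounded_linear_imp_has_derivative bounded_linear_complex_scaling)
  have L_plane: "L \<zeta> \<in> F ` (V \<inter> in_chart c S)" if "L \<zeta> \<in> W" for \<zeta>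
  proof -
    have "F z0 \<in> {w \<in> W. \<forall>i. i \<notin> I \<longrightarrow> w $ i = 0}" using z0S plane by blast
    then show ?thesis
      unfolding plane using that i0 by (auto simp: L_def axis_def)
  qed
  define f where "f = (\<lambda>\<zeta>. G (L \<zeta>))"
  define u where "u = (\<lambda>\<zeta>. frechet_derivative G (at (L \<zeta>)) (axis i0 1))"
  have f_der: "(f has_derivative (\<lambda>t. t *s u \<zeta>)) (at \<zeta>)" if "L \<zeta> \<in> W" for \<zeta>
    unfolding f_def u_def by (rule holomorphic_map_comp_complex_curve[OF holG that L])
  have f_in: "f \<zeta> \<in> V \<inter> in_chart c S" if "L \<zeta> \<in> W" for \<zeta>
    using L_plane[OF that] GF unfolding f_def by auto
  have "F z0 \<in> W" using z0 bijF by (auto simp: bij_betw_def)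
  then have L0: "L 0 \<in> W" "f 0 = z0" using GF[OF z0(1)] by (simp_all add: L_def f_def)
  \<comment> \<open>The radius is to keep the line in \<open>W\<close> and its preimage in the
    domain \<open>U\<close> of the local representation.\<close>
  have "isCont L 0" using L by (rule has_derivative_continuous)
  then have "\<forall>\<^sub>F \<zeta> in nhds 0. L \<zeta> \<in> W"
    using openW L0 by (simp add: continuous_at_open eventually_nhds)
  moreover have "isCont f 0" using f_der[OF L0(1)] by (rule has_derivative_continuous)
  then have "\<forall>\<^sub>F \<zeta> in nhds 0. f \<zeta> \<in> U"
    using U L0 by (simp add: continuous_at_open eventually_nhds)
  ultimately have "\<forall>\<^sub>F \<zeta> in nhds 0. L \<zeta> \<in> W \<and> f \<zeta> \<in> U" by (rule eventually_conj)
  then obtain \<epsilon> where \<epsilon>: "\<epsilon> > 0" "\<And>\<zeta>. \<zeta> \<in> ball 0 \<epsilon> \<Longrightarrow> L \<zeta> \<in> W" "\<And>\<zeta>. \<zeta> \<in> ball 0 \<epsilon> \<Longrightarrow> f \<zeta> \<in> U"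
    unfolding eventually_nhds_metric by (auto simp: dist_commute)
  define g where "g = (\<lambda>\<zeta>. h (f \<zeta>))"
  define v where "v = (\<lambda>\<zeta>. frechet_derivative h (at (f \<zeta>)) (u \<zeta>))"
  have g_der: "(g has_derivative (\<lambda>t. t *s v \<zeta>)) (at \<zeta>)" if "\<zeta> \<in> ball 0 \<epsilon>" for \<zeta>
    unfolding g_def v_def by (rule holomorphic_map_comp_complex_curve[OF h \<epsilon>(3)[OF that] f_der[OF \<epsilon>(2)[OF that]]])
  note f_comp = complex_curve_component_derivative[OF f_der[OF \<epsilon>(2)]]
    and g_comp = complex_curve_component_derivative[OF g_der]
  have inj_f: "inj_on f (ball 0 \<epsilon>)"
  proof (rule inj_onI)
    fix x y assume xy: "x \<in> ball 0 \<epsilon>" "y \<in> ball 0 \<epsilon>" "f x = f y"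
    then have "L x = L y" using FG \<epsilon>(2) unfolding f_def by metis
    then have "(x *s axis i0 1) $ i0 = (y *s axis i0 (1::complex)) $ i0" by (simp add: L_def)
    then show "x = y" by simp
  qed
  show ?thesis
  proof (intro exI[of _ \<epsilon>] exI[of _ f] exI[of _ g] conjI allI ballI)
    show "(\<lambda>\<zeta>. f \<zeta> $ i) holomorphic_on ball 0 \<epsilon>" for i
      by (rule holomorphic_onI) (metis f_comp field_differentiable_at_within field_differentiable_def)
    show "(\<lambda>\<zeta>. g \<zeta> $ k) holomorphic_on ball 0 \<epsilon>" for k
      by (rule holomorphic_onI) (metis g_comp field_differentiable_at_within field_differentiable_def)
    show "inj_on g (ball 0 \<epsilon>)"
    proof (rule inj_onI)
      fix x y assume xy: "x \<in> ball 0 \<epsilon>" "y \<in> ball 0 \<epsilon>" "g x = g y"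
      \<comment> \<open>Equal values of \<open>g\<close> give equal values of \<open>\<phi>\<close>,
        which is injective on \<open>S\<close>; then \<open>param c\<close> and \<open>f\<close> are
        injective in turn.\<close>
      have rep_f: "\<phi> (param c (f \<zeta>)) = param d (g \<zeta>)" "param c (f \<zeta>) \<in> S" if "\<zeta> \<in> ball 0 \<epsilon>" for \<zeta>
        using \<phi>[of "f \<zeta>"] f_in[OF \<epsilon>(2)[OF that]] \<epsilon>(3)[OF that] by (auto simp: g_def in_chart_def)
      have "\<phi> (param c (f x)) = \<phi> (param c (f y))" using rep_f xy by simp
      then have "param c (f x) = param c (f y)"
        using bij rep_f(2) xy by (meson bij_betw_imp_inj_on inj_onD)
      then show "x = y" using charts(1) inj_f xy by (meson injD inj_onD)
    qed
    show "kahler_metric (fs_potential a) (g \<zeta>) (\<chi> k. deriv (\<lambda>\<zeta>. g \<zeta> $ k) \<zeta>) (\<chi> k. deriv (\<lambda>\<zeta>. g \<zeta> $ k) \<zeta>) =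
        kahler_metric (fs_potential b) (f \<zeta>) (\<chi> i. deriv (\<lambda>\<zeta>. f \<zeta> $ i) \<zeta>) (\<chi> i. deriv (\<lambda>\<zeta>. f \<zeta> $ i) \<zeta>)"
      if \<zeta>: "\<zeta> \<in> ball 0 \<epsilon>" for \<zeta>
    proof -
      have "u \<zeta> \<in> tangent_space (in_chart c S) (f \<zeta>)"
        by (rule complex_curve_tangent[OF f_der[OF \<epsilon>(2)[OF \<zeta>]] open_ball \<zeta>]) (use f_in \<epsilon>(2) in blast)
      \<comment> \<open>The representation found at \<open>z0\<close> is one at every point of
        \<open>U\<close>, so the isometry condition applies along the whole curve.\<close>
      moreover have "local_rep c d S \<phi> (f \<zeta>) U h"
        using rep \<epsilon>(3)[OF \<zeta>] unfolding local_rep_def by blast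
      moreover have "f \<zeta> \<in> in_chart c S" using f_in[OF \<epsilon>(2)[OF \<zeta>]] by blast
      ultimately have "kahler_metric (potential d) (h (f \<zeta>)) (v \<zeta>) (v \<zeta>) =
          kahler_metric (potential c) (f \<zeta>) (u \<zeta>) (u \<zeta>)"
        using isom c d(1) unfolding isometric_on_def v_def by blast
      moreover have "(\<chi> i. deriv (\<lambda>\<zeta>. f \<zeta> $ i) \<zeta>) = u \<zeta>" "(\<chi> k. deriv (\<lambda>\<zeta>. g \<zeta> $ k) \<zeta>) = v \<zeta>"
        using DERIV_imp_deriv[OF f_comp[OF \<zeta>]] DERIV_imp_deriv[OF g_comp[OF \<zeta>]] by (simp_all add: vec_eq_iff)
      ultimately show ?thesis by (simp add: charts g_def)
    qed
  qed (use \<epsilon> inj_f in auto)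
qed

section \<open>Homogeneous lifts and the rank bound for a pair of curves\<close>

lemma affine_lift_None_nth:
  "affine_lift b None Z $ None = 1" "affine_lift b None Z $ Some i = complex_of_real (sqrt b) * Z $ i"
  by (simp_all add: affine_lift_def)

lemma sum_UNIV_option: "(\<Sum>l\<in>UNIV. h l) = h None + (\<Sum>i\<in>(UNIV :: 'a::finite set). h (Some i))"
  by (simp add: UNIV_option_conv sum.reindex)

text \<open>In the lift, 1 + b |f|^2 becomes the squared norm of \<open>F\<close>, and the constant
  coordinate drops out of the derivatives. Up to constants the metric is then the Gram determinant
  of \<open>F\<close> and its derivative over the fourth power of the norm. The lift at
  \<open>None\<close> serves for a curve from any chart, since only the potential enters.\<close>

lemma affine_lift_curve_metric:
  fixes f :: "complex \<Rightarrow> complex^'n" and b :: real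
  defines "F \<equiv> (\<lambda>l \<zeta>. affine_lift b None (f \<zeta>) $ l)"
    and "u \<equiv> (\<lambda>\<zeta>. \<chi> i. deriv (\<lambda>\<zeta>. f \<zeta> $ i) \<zeta>)"
  assumes "b > 0" and f: "\<And>i. (\<lambda>\<zeta>. f \<zeta> $ i) holomorphic_on D" and "open D" "\<zeta> \<in> D"
  shows "2 * ((\<Sum>l\<in>UNIV. F l \<zeta> * cnj (F l \<zeta>)) * (\<Sum>l\<in>UNIV. deriv (F l) \<zeta> * cnj (deriv (F l) \<zeta>)) -
      (\<Sum>l\<in>UNIV. deriv (F l) \<zeta> * cnj (F l \<zeta>)) * (\<Sum>l\<in>UNIV. F l \<zeta> * cnj (deriv (F l) \<zeta>))) =
    complex_of_real (b * kahler_metric (fs_potential b) (f \<zeta>) (u \<zeta>) (u \<zeta>)) *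
      (\<Sum>l\<in>UNIV. F l \<zeta> * cnj (F l \<zeta>))\<^sup>2"
proof -
  have dS: "deriv (\<lambda>\<zeta>. complex_of_real (sqrt b) * f \<zeta> $ i) \<zeta> = complex_of_real (sqrt b) * u \<zeta> $ i" for i
    unfolding u_def using holomorphic_derivI[OF f \<open>open D\<close> \<open>\<zeta> \<in> D\<close>]
    by (simp add: DERIV_imp_deriv[OF DERIV_cmult])
  have sqrt: "complex_of_real (sqrt b) * x * cnj (complex_of_real (sqrt b) * y) = complex_of_real b * (x * cnj y)" for x y
  proof -
    have "complex_of_real (sqrt b) * x * cnj (complex_of_real (sqrt b) * y) =
        (complex_of_real (sqrt b) * complex_of_real (sqrt b)) * (x * cnj y)"
      by (simp only: complex_cnj_mult complex_cnj_complex_of_real mult_ac)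
    also have "complex_of_real (sqrt b) * complex_of_real (sqrt b) = complex_of_real b"
      using \<open>b > 0\<close> by (simp flip: of_real_mult)
    finally show ?thesis .
  qed
  have sums: "(\<Sum>l\<in>UNIV. F l \<zeta> * cnj (F l \<zeta>)) = 1 + b * (\<Sum>i\<in>UNIV. f \<zeta> $ i * cnj (f \<zeta> $ i))"
    "(\<Sum>l\<in>UNIV. deriv (F l) \<zeta> * cnj (deriv (F l) \<zeta>)) = b * (\<Sum>i\<in>UNIV. u \<zeta> $ i * cnj (u \<zeta> $ i))"
    "(\<Sum>l\<in>UNIV. deriv (F l) \<zeta> * cnj (F l \<zeta>)) = b * (\<Sum>i\<in>UNIV. u \<zeta> $ i * cnj (f \<zeta> $ i))"
    "(\<Sum>l\<in>UNIV. F l \<zeta> * cnj (deriv (F l) \<zeta>)) = b * (\<Sum>i\<in>UNIV. f \<zeta> $ i * cnj (u \<zeta> $ i))"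
    unfolding F_def sum_UNIV_option affine_lift_None_nth dS sqrt by (simp_all add: sum_distrib_left)
  have "2 * (P * (b * U) - b * c * (b * d)) = complex_of_real (b * m) * P\<^sup>2"
    if "complex_of_real m * P\<^sup>2 = 2 * (P * U - b * c * d)" for m and P U c d :: complex
    using that unfolding of_real_mult by algebra
  from this[OF kahler_metric_fs_potential[OF \<open>b > 0\<close>]] show ?thesis
    unfolding sums .
qed

text \<open>One inequality, stated so that it can be used again with the curves exchanged: the
  injective curve \<open>f\<close> supplies \<open>r + 1\<close> independent powers, the lift of
  \<open>g\<close> a bounded number of monomials.\<close>

lemma fubini_study_curve_rank_bound:
  fixes f :: "complex \<Rightarrow> complex^'n" and g :: "complex \<Rightarrow> complex^'m"
  assumes pos: "0 < \<epsilon>" "0 < b" "0 < a"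
    and f: "\<And>i. (\<lambda>\<zeta>. f \<zeta> $ i) holomorphic_on ball 0 \<epsilon>"
    and g: "\<And>k. (\<lambda>\<zeta>. g \<zeta> $ k) holomorphic_on ball 0 \<epsilon>"
    and inj: "inj_on f (ball 0 \<epsilon>)"
    and metric: "\<And>\<zeta>. \<zeta> \<in> ball 0 \<epsilon> \<Longrightarrow>
      kahler_metric (fs_potential a) (g \<zeta>) (\<chi> k. deriv (\<lambda>\<zeta>. g \<zeta> $ k) \<zeta>) (\<chi> k. deriv (\<lambda>\<zeta>. g \<zeta> $ k) \<zeta>) =
      kahler_metric (fs_potential b) (f \<zeta>) (\<chi> i. deriv (\<lambda>\<zeta>. f \<zeta> $ i) \<zeta>) (\<chi> i. deriv (\<lambda>\<zeta>. f \<zeta> $ i) \<zeta>)"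
    and ratio: "real r * b = real s * a"
  shows "r + 1 \<le> (s + CARD('m)) choose s"
proof -
  define F where "F = (\<lambda>l \<zeta>. affine_lift b None (f \<zeta>) $ l)"
  define G where "G = (\<lambda>l \<zeta>. affine_lift a None (g \<zeta>) $ l)"
  have F: "F l holomorphic_on ball 0 \<epsilon>" for l
    unfolding F_def using f by (cases l) (auto simp: affine_lift_None_nth intro!: holomorphic_intros)
  have G: "G l holomorphic_on ball 0 \<epsilon>" for l
    unfolding G_def using g by (cases l) (auto simp: affine_lift_None_nth intro!: holomorphic_intros)
  have nz: "(\<Sum>l\<in>UNIV. H l * cnj (H l)) \<noteq> 0" if "H l0 = 1" for H :: "'l::finite \<Rightarrow> complex" and l0
  proof -
    have "(\<Sum>l\<in>UNIV. (cmod (H l))\<^sup>2) \<noteq> 0"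
      using that by (subst sum_nonneg_eq_0_iff) force+
    then show ?thesis
      by (simp only: complex_norm_square[symmetric] of_real_sum[symmetric] of_real_eq_0_iff not_False_eq_True)
  qed
  have "(\<Sum>l\<in>UNIV. F l 0 * cnj (F l 0)) \<noteq> 0" "(\<Sum>l\<in>UNIV. G l 0 * cnj (G l 0)) \<noteq> 0"
    by (rule nz[of _ None], simp add: F_def G_def affine_lift_None_nth)+
  moreover have "of_nat r * ((\<Sum>l\<in>UNIV. F l \<zeta> * cnj (F l \<zeta>)) * (\<Sum>l\<in>UNIV. deriv (F l) \<zeta> * cnj (deriv (F l) \<zeta>)) -
        (\<Sum>l\<in>UNIV. deriv (F l) \<zeta> * cnj (F l \<zeta>)) * (\<Sum>l\<in>UNIV. F l \<zeta> * cnj (deriv (F l) \<zeta>))) *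
      (\<Sum>l\<in>UNIV. G l \<zeta> * cnj (G l \<zeta>))\<^sup>2 =
    of_nat s * ((\<Sum>l\<in>UNIV. G l \<zeta> * cnj (G l \<zeta>)) * (\<Sum>l\<in>UNIV. deriv (G l) \<zeta> * cnj (deriv (G l) \<zeta>)) -
        (\<Sum>l\<in>UNIV. deriv (G l) \<zeta> * cnj (G l \<zeta>)) * (\<Sum>l\<in>UNIV. G l \<zeta> * cnj (deriv (G l) \<zeta>))) *
      (\<Sum>l\<in>UNIV. F l \<zeta> * cnj (F l \<zeta>))\<^sup>2" if \<zeta>: "\<zeta> \<in> ball 0 \<epsilon>" for \<zeta>
  proof -
    \<comment> \<open>Here \<open>m\<close> is the common value of the two metrics, and
      \<open>ratio\<close> turns \<open>r * b * m\<close> into \<open>s * a * m\<close>.\<close>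
    have cancel: "of_nat r * x * l\<^sup>2 = of_nat s * y * k\<^sup>2"
      if "2 * x = complex_of_real (b * m) * k\<^sup>2" "2 * y = complex_of_real (a * m) * l\<^sup>2" for x y k l :: complex and m
    proof -
      have "complex_of_nat r * complex_of_real b = complex_of_nat s * complex_of_real a"
        using arg_cong[OF ratio, of complex_of_real] by simp
      then have "2 * (of_nat r * x * l\<^sup>2) = 2 * (of_nat s * y * k\<^sup>2)"
        using that unfolding of_real_mult by algebra
      then show ?thesis by simp
    qed
    show ?thesis
      using affine_lift_curve_metric[OF pos(2) f open_ball \<zeta>] affine_lift_curve_metric[OF pos(3) g open_ball \<zeta>]
      unfolding metric[OF \<zeta>] F_def G_def by (rule cancel)
  qed
  ultimately have "\<exists>\<delta> \<phi> \<psi>. 0 < \<delta> \<and> \<delta> \<le> \<epsilon> \<and> (\<forall>z\<in>ball 0 \<delta>. \<forall>w\<in>ball 0 \<delta>.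
      (\<Sum>l\<in>UNIV. F l z * cnj (F l w)) ^ r = \<phi> z * \<psi> w * (\<Sum>l\<in>UNIV. G l z * cnj (G l w)) ^ s)"
    by (rule hermitian_kernel_powers_separate[OF pos(1) F G])
  then obtain \<delta> \<phi> \<psi> where \<delta>: "0 < \<delta>" "\<delta> \<le> \<epsilon>"
    and sep: "\<forall>z\<in>ball 0 \<delta>. \<forall>w\<in>ball 0 \<delta>.
      (\<Sum>l\<in>UNIV. F l z * cnj (F l w)) ^ r = \<phi> z * \<psi> w * (\<Sum>l\<in>UNIV. G l z * cnj (G l w)) ^ s"
    by (elim exE conjE)
  \<comment> \<open>A coordinate with finitely many values on the connected ball is constant; if all
    were, \<open>f\<close> could not be injective.\<close>
  have "\<exists>l. infinite (F l ` ball 0 \<delta>)"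
  proof (rule ccontr)
    assume fin: "\<not> ?thesis"
    have "f x $ i = f y $ i" if "x \<in> ball 0 \<delta>" "y \<in> ball 0 \<delta>" for x y i
    proof -
      have "continuous_on (ball 0 \<delta>) (F (Some i))"
        by (rule continuous_on_subset[OF holomorphic_on_imp_continuous_on[OF F] subset_ball[OF \<delta>(2)]])
      then have conn: "connected (F (Some i) ` ball 0 \<delta>)"
        by (rule connected_continuous_image) simp
      have "finite (F (Some i) ` ball 0 \<delta>)" using fin by blast
      with connected_finite_iff_sing[OF conn]
      have "F (Some i) ` ball 0 \<delta> = {} \<or> (\<exists>c. F (Some i) ` ball 0 \<delta> = {c})" by (rule iffD1)
      then have "F (Some i) x = F (Some i) y"
        using imageI[OF that(1), of "F (Some i)"] imageI[OF that(2), of "F (Some i)"]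
        by (elim disjE exE) (simp_all only: singleton_iff empty_iff)
      then show ?thesis using pos(2) by (simp add: F_def affine_lift_None_nth)
    qed
    then have "f 0 = f (of_real (\<delta> / 2))"
      using \<delta>(1) by (simp add: vec_eq_iff)
    then have "(0::complex) = of_real (\<delta> / 2)"
      by (rule inj_onD[OF inj]) (use \<delta> in auto)
    then show False using \<delta>(1) by simp
  qed
  then obtain l0 where "infinite (F l0 ` ball 0 \<delta>)" by blast
  moreover have "F None z = 1" for z
    by (simp add: F_def affine_lift_None_nth)
  \<comment> \<open>The extra homogeneous coordinate of \<open>G\<close> cancels against the
    \<open>- 1\<close> of the monomial count.\<close>
  ultimately have "Suc r \<le> (s + CARD('m option) - 1) choose s"
    by (intro hermitian_power_rank_bound[where X = "ball 0 \<delta>" and F = F and G = G and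
          \<phi> = \<phi> and \<psi> = \<psi> and ?l1.0 = None and ?l0.0 = l0] sep[rule_format])
  then show ?thesis
    by simp
qed

theorem corollary4p5:
  fixes a b :: real and s r :: nat
  assumes "a > 0" and "b > 0" and "a / b \<in> \<rat>"
    and "relatives (fubini_study TYPE('n::finite) b) (fubini_study TYPE('m::finite) a)"
    and "s > 0" and "r > 0" and "gcd s r = 1"
    and "real s * a = real r * b"
  shows "r + 1 \<le> (s + CARD('m)) choose s \<and> s + 1 \<le> (r + CARD('n)) choose r"
proof -
  from fubini_study_relatives_common_curve[OF assms(2,1,4)]
  obtain \<epsilon> and f :: "complex \<Rightarrow> complex^'n" and g :: "complex \<Rightarrow> complex^'m" where
    eps: "0 < \<epsilon>" and f: "\<forall>i. (\<lambda>\<zeta>. f \<zeta> $ i) holomorphic_on ball 0 \<epsilon>"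
    and g: "\<forall>k. (\<lambda>\<zeta>. g \<zeta> $ k) holomorphic_on ball 0 \<epsilon>"
    and inj: "inj_on f (ball 0 \<epsilon>)" "inj_on g (ball 0 \<epsilon>)"
    and metric: "\<forall>\<zeta>\<in>ball 0 \<epsilon>.
      kahler_metric (fs_potential a) (g \<zeta>) (\<chi> k. deriv (\<lambda>\<zeta>. g \<zeta> $ k) \<zeta>) (\<chi> k. deriv (\<lambda>\<zeta>. g \<zeta> $ k) \<zeta>) =
      kahler_metric (fs_potential b) (f \<zeta>) (\<chi> i. deriv (\<lambda>\<zeta>. f \<zeta> $ i) \<zeta>) (\<chi> i. deriv (\<lambda>\<zeta>. f \<zeta> $ i) \<zeta>)"
    by (elim exE conjE)
  note metric' = bspec[OF metric]
  show ?thesis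
  proof
    show "r + 1 \<le> (s + CARD('m)) choose s"
      by (rule fubini_study_curve_rank_bound[OF eps assms(2,1) f[rule_format] g[rule_format] inj(1)
            metric' assms(8)[symmetric]])
    \<comment> \<open>Exchanging curves, spaces and exponents reverses both the metric identity and
      the relation between \<open>a\<close> and \<open>b\<close>.\<close>
    show "s + 1 \<le> (r + CARD('n)) choose r"
      by (rule fubini_study_curve_rank_bound[OF eps assms(1,2) g[rule_format] f[rule_format] inj(2)
            metric'[symmetric] assms(8)])
  qed
qed

end
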